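(* Let $x_0>0$ and let $(h_t)_{t\ge0}$ be a family of holomorphic functions in $\mathbb{H}(x_0):=\{z\in\mathbb{C}:\operatorname{Re}z>x_0\}$ satisfying the following conditions: (i) the map $\mathbb{H}(x_0)\times[0,+\infty)\ni(z,t)\mapsto h_t(z)$ is continuous and for each $z\in\mathbb{H}(x_0)$ the map $[0,+\infty)\ni t\mapsto h_t(z)$ is locally absolutely continuous; (ii) there exist constants $0<C_1<C_2<+\infty$ and a Herglotz function $p:\mathbb{H}\times[0,+\infty)\to\Pi:=\{\zeta: C_1<\operatorname{Re}\zeta<C_2\}$ such that for each $z\in\mathbb{H}(x_0)$, $$\frac{\partial h_t(z)}{\partial t}=-h_t'(z)p(z,t)\quad\text{for a.e. } t\ge0;$$ (iii) there exists $a>x_0$ such that $$\liminf_{t\to+\infty}\ \inf_{\operatorname{Re}z>a+C_1t}\frac{\mathsf{R}_u(h_t,z)}{\operatorname{Re}z}>0,$$ where $\mathsf{R}_u(f,z)$ stands for the (Euclidean) radius of univalence of a function $f$ at the point $z$. Then for every $t\ge0$ the function $h_t$ extends to a univalent holomorphic function $g_t:\mathbb{H}\to\mathbb{C}$, with $(g_t)_{t\ge0}$ being a Loewner chain associated with the Herglotz function $p$.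
   Context: $\mathbb{H}:=\{z\in\mathbb{C}:\operatorname{Re} z>0\}$. A Herglotz function in $\mathbb{H}$ is $p:\mathbb{H}\times[0,+\infty)\to\mathbb{C}$ with $p(\cdot,t)$ holomorphic for a.e. $t\ge0$, $p(z,\cdot)$ locally integrable on $[0,+\infty)$ for every $z\in\mathbb{H}$, and $\operatorname{Re}p\ge0$. The evolution family associated with $p$ is the unique family $(\varphi_{s,t})_{0\le s\le t}$ of holomorphic self-maps of $\mathbb{H}$ such that for every $z\in\mathbb{H}$, $s\ge0$, $t\mapsto\varphi_{s,t}(z)$, $t\ge s$, is the (locally absolutely continuous, Carathéodory) solution of $\frac{d}{dt}\varphi_{s,t}(z)=p(\varphi_{s,t}(z),t)$ a.e., $\varphi_{s,s}(z)=z$. A Loewner chain in $\mathbb{H}$ is a family $(f_t)_{t\ge0}$ of univalent holomorphic functions $f_t:\mathbb{H}\to\mathbb{C}$ with $f_s(\mathbb{H})\subset f_t(\mathbb{H})$ for $0\le s<t$, and such that for each compact $K\subset\mathbb{H}$ there is a non-negative locally integrable $k_K$ on $[0,+\infty)$ with $|f_s(z)-f_t(z)|\le\int_s^tk_K(\xi)\,d\xi$ for $z\in K$, $0\le s\le t$. It is associated with $p$ if $f_t^{-1}\circ f_s=\varphi_{s,t}$ for all $0\le s\le t$. The radius of univalence $\mathsf{R}_u(f,z)$ is the supremum of all $r>0$ such that the disk $\{w:|w-z|<r\}$ lies in the domain of $f$ and $f$ is univalent (injective) in it (and $0$ if there is no such $r$). *)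

theory Defs
  imports "HOL-Complex_Analysis.Complex_Analysis"
begin

text \<open>
  Time-dependent objects are total functions on \<^typ>\<open>real\<close>; only their values at times
  \<open>t \<ge> 0\<close> are ever constrained or used. Likewise functions on a half-plane are total
  functions on \<^typ>\<open>complex\<close> whose values off the half-plane are irrelevant.
\<close>

definition half_plane :: "real \<Rightarrow> complex set" where
  "half_plane c = {z. c < Re z}"

abbreviation right_half_plane :: "complex set" where
  "right_half_plane \<equiv> half_plane 0"

definition univalent_on :: "(complex \<Rightarrow> complex) \<Rightarrow> complex set \<Rightarrow> bool" where
  "univalent_on f S \<longleftrightarrow> f holomorphic_on S \<and> inj_on f S"

definition locally_integrable :: "(real \<Rightarrow> 'a :: euclidean_space) \<Rightarrow> bool" where
  "locally_integrable f \<longleftrightarrow> (\<forall>T\<ge>0. set_integrable lebesgue {0..T} f)"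

text \<open>
  Absolute continuity of a function on a compact interval. (The library constant
  \<open>absolutely_continuous\<close> is about measures.)
\<close>

definition abs_continuous_on_interval ::
    "real \<Rightarrow> real \<Rightarrow> (real \<Rightarrow> 'a :: real_normed_vector) \<Rightarrow> bool" where
  "abs_continuous_on_interval a b f \<longleftrightarrow>
     (\<forall>\<epsilon>>0. \<exists>\<delta>>0. \<forall>(n::nat) u v.
        (\<forall>i<n. a \<le> u i \<and> u i \<le> v i \<and> v i \<le> b) \<longrightarrow>
        disjoint_family_on (\<lambda>i. {u i<..<v i}) {..<n} \<longrightarrow>
        (\<Sum>i<n. v i - u i) < \<delta> \<longrightarrow>
        (\<Sum>i<n. norm (f (v i) - f (u i))) < \<epsilon>)"

definition locally_abs_continuous_from ::
    "real \<Rightarrow> (real \<Rightarrow> 'a :: real_normed_vector) \<Rightarrow> bool" where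
  "locally_abs_continuous_from s f \<longleftrightarrow> (\<forall>T\<ge>s. abs_continuous_on_interval s T f)"

definition herglotz_function :: "(complex \<Rightarrow> real \<Rightarrow> complex) \<Rightarrow> bool" where
  "herglotz_function p \<longleftrightarrow>
     (AE t in lebesgue. 0 \<le> t \<longrightarrow> (\<lambda>z. p z t) holomorphic_on right_half_plane) \<and>
     (\<forall>z\<in>right_half_plane. locally_integrable (p z)) \<and>
     (\<forall>z\<in>right_half_plane. \<forall>t\<ge>0. 0 \<le> Re (p z t))"

text \<open>
  \<open>\<phi> s t\<close> is the map from time \<open>s\<close> to time \<open>t\<close>. The Caratheodory initial value
  problem determines \<open>\<phi> s t z\<close> uniquely for \<open>0 \<le> s \<le> t\<close> and \<open>z\<close> in the half-plane.
\<close>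

definition evolution_family_of ::
    "(complex \<Rightarrow> real \<Rightarrow> complex) \<Rightarrow> (real \<Rightarrow> real \<Rightarrow> complex \<Rightarrow> complex) \<Rightarrow> bool" where
  "evolution_family_of p \<phi> \<longleftrightarrow>
     (\<forall>s t. 0 \<le> s \<and> s \<le> t \<longrightarrow>
        \<phi> s t holomorphic_on right_half_plane \<and>
        \<phi> s t ` right_half_plane \<subseteq> right_half_plane) \<and>
     (\<forall>z\<in>right_half_plane. \<forall>s\<ge>0.
        \<phi> s s z = z \<and>
        locally_abs_continuous_from s (\<lambda>t. \<phi> s t z) \<and>
        (AE t in lebesgue. s \<le> t \<longrightarrow>
           ((\<lambda>t. \<phi> s t z) has_vector_derivative p (\<phi> s t z) t) (at t within {s..})))"

definition loewner_chain :: "(real \<Rightarrow> complex \<Rightarrow> complex) \<Rightarrow> bool" where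
  "loewner_chain f \<longleftrightarrow>
     (\<forall>t\<ge>0. univalent_on (f t) right_half_plane) \<and>
     (\<forall>s t. 0 \<le> s \<and> s < t \<longrightarrow> f s ` right_half_plane \<subseteq> f t ` right_half_plane) \<and>
     (\<forall>K. compact K \<and> K \<subseteq> right_half_plane \<longrightarrow>
        (\<exists>k :: real \<Rightarrow> real. (\<forall>\<xi>\<ge>0. 0 \<le> k \<xi>) \<and> locally_integrable k \<and>
           (\<forall>z\<in>K. \<forall>s t. 0 \<le> s \<and> s \<le> t \<longrightarrow>
              cmod (f s z - f t z) \<le> (LINT \<xi>:{s..t}|lebesgue. k \<xi>))))"

definition loewner_chain_associated ::
    "(real \<Rightarrow> complex \<Rightarrow> complex) \<Rightarrow> (complex \<Rightarrow> real \<Rightarrow> complex) \<Rightarrow> bool" where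
  "loewner_chain_associated f p \<longleftrightarrow>
     loewner_chain f \<and>
     (\<exists>\<phi>. evolution_family_of p \<phi> \<and>
        (\<forall>s t. 0 \<le> s \<and> s \<le> t \<longrightarrow>
           (\<forall>z\<in>right_half_plane. inv_into right_half_plane (f t) (f s z) = \<phi> s t z)))"

text \<open>
  Radius of univalence at \<open>z\<close> of a function \<open>f\<close> with domain \<open>D\<close>. Inserting \<open>0\<close> gives
  the value \<open>0\<close> when no disk is admissible; otherwise it does not affect the supremum.
\<close>

definition radius_of_univalence ::
    "complex set \<Rightarrow> (complex \<Rightarrow> complex) \<Rightarrow> complex \<Rightarrow> ereal" where
  "radius_of_univalence D f z =
     (SUP r\<in>insert 0 {r. 0 < r \<and> ball z r \<subseteq> D \<and> inj_on f (ball z r)}. ereal r)"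

end

theory Submission
  imports Defs
begin

text \<open>
  Let \<open>flow s t\<close> be the evolution family of the field \<open>p\<close>: it sends \<open>z\<close> to the value at time
  \<open>t\<close> of the solution of \<open>w' = p(w, t)\<close> that starts at \<open>z\<close> at time \<open>s\<close>. The differential
  equation for \<open>h\<close> says that \<open>h\<close> is constant along trajectories (\<open>transport_along_flow\<close>). As
  \<open>Re p > C1\<close>, every trajectory in the right half-plane lies in \<open>half_plane x0\<close> once the time
  \<open>x0 / C1\<close> has elapsed. Hence \<open>g t z = h T (flow t T z)\<close> does not depend on
  \<open>T \<ge> t + x0 / C1\<close>, extends \<open>h t\<close> holomorphically to the right half-plane, and satisfies
  \<open>g t \<circ> flow s t = g s\<close>. What remains is that \<open>g t\<close> is injective.

  Both bounds on \<open>Re p\<close> enter here. The map \<open>flow s (s + 1) - C1\<close> preserves the right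
  half-plane, so by Schwarz-Pick it does not increase hyperbolic distances; adding \<open>C1\<close> back
  pushes the points away from the boundary, and if their real parts are then at most \<open>R\<close>, this
  shrinks \<open>|z - w| / sqrt (Re z * Re w)\<close>, a measure of the hyperbolic distance, at least by the
  factor \<open>exp (- C1 / R)\<close> (\<open>flow_unit_step_contracts\<close>).
  Since \<open>Re p < C2\<close>, the bound \<open>R\<close> grows only linearly in time, and because the harmonic series
  diverges, the hyperbolic distance of two trajectories tends to \<open>0\<close>. Their Euclidean distance
  at time \<open>T\<close> is therefore \<open>o(T)\<close> (\<open>flow_distance_sublinear\<close>). On the other hand, the lower
  bound for the radius of univalence yields a disk with radius proportional to \<open>T\<close>, with its
  centre at a bounded distance from the first trajectory, on which \<open>h T\<close> is injective. For large
  \<open>T\<close> it contains both trajectories, so \<open>g t z = g t w\<close> forces \<open>flow t T z = flow t T w\<close>, and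
  then \<open>z = w\<close> by uniqueness for the differential equation (\<open>transported_maps_injective\<close>).

  The flow is obtained by Picard iteration. By Schwarz-Pick again, a holomorphic map of the
  half-plane into the strip is Lipschitz on \<open>Re z \<ge> \<epsilon>\<close> with the constant \<open>C2 / \<epsilon>\<close>, uniformly
  in time, and trajectories never move to the left; so the iteration converges locally uniformly
  and its limit is holomorphic in the initial point. Two facts about the real line carry the
  passage between integral equations and derivatives almost everywhere: an absolutely continuous
  function is the integral of its derivative, and an indefinite integral is differentiable
  almost everywhere.
\<close>

section \<open>Absolutely continuous functions and indefinite integrals\<close>

text \<open>
  Outside the null set \<open>N\<close> the increments are approximated by the derivative, as in the usual
  fundamental theorem for gauge integrals. The tags in \<open>N\<close> are handled by choosing the gauge such
  that their intervals stay inside an open set of small measure; absolute continuity makes the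
  total increment over these intervals small.
\<close>

lemma has_integral_abs_continuous:
  fixes f :: "real \<Rightarrow> 'a::euclidean_space"
  assumes "a \<le> b" and ac: "abs_continuous_on_interval a b f" and N: "negligible N"
    and der: "\<And>x. x \<in> {a..b} - N \<Longrightarrow> (f has_vector_derivative f' x) (at x within {a..b})"
  shows "(f' has_integral (f b - f a)) {a..b}"
proof (cases "a = b")
  case False
  with \<open>a \<le> b\<close> have "a < b" by simp
  \<comment> \<open>On \<open>N\<close> the integrand may be chosen freely; with \<open>0\<close> the tags in \<open>N\<close> contribute only increments of \<open>f\<close>.\<close>
  define g where "g x = (if x \<in> N then 0 else f' x)" for x
  have "(g has_integral (f b - f a)) {a..b}"
    unfolding has_integral_factor_content box_real[symmetric]
  proof safe
    fix e :: real assume "e > 0"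
    define e2 where "e2 = e / 2"
    have e2: "e2 > 0" using \<open>e > 0\<close> by (simp add: e2_def)
    have "e2 * (b - a) > 0" using e2 \<open>a < b\<close> by simp
    then have "\<exists>\<delta>>0. \<forall>(n::nat) u v. (\<forall>i<n. a \<le> u i \<and> u i \<le> v i \<and> v i \<le> b) \<longrightarrow>
        disjoint_family_on (\<lambda>i. {u i<..<v i}) {..<n} \<longrightarrow>
        (\<Sum>i<n. v i - u i) < \<delta> \<longrightarrow> (\<Sum>i<n. norm (f (v i) - f (u i))) < e2 * (b - a)"
      using ac unfolding abs_continuous_on_interval_def by (elim allE impE)
    then obtain \<delta> where "\<delta> > 0" and \<delta>:
      "\<And>(n::nat) u v. (\<forall>i<n. a \<le> u i \<and> u i \<le> v i \<and> v i \<le> b) \<Longrightarrow>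
        disjoint_family_on (\<lambda>i. {u i<..<v i}) {..<n} \<Longrightarrow>
        (\<Sum>i<n. v i - u i) < \<delta> \<Longrightarrow> (\<Sum>i<n. norm (f (v i) - f (u i))) < e2 * (b - a)"
      by meson
    have "N \<in> sets lebesgue" using N negligible_imp_sets by blast
    then obtain T where T: "open T" "N \<subseteq> T" "T - N \<in> lmeasurable" "emeasure lebesgue (T - N) < ennreal \<delta>"
      using sets_lebesgue_outer_open[OF _ \<open>\<delta> > 0\<close>] by blast
    have NL: "N \<in> lmeasurable" "measure lebesgue N = 0"
      using N negligible_iff_measure by auto
    have "T = (T - N) \<union> N" using T by blast
    then have TL: "T \<in> lmeasurable" using fmeasurable.Un[OF T(3) NL(1)] by simp
    have "measure lebesgue T \<le> measure lebesgue (T - N) + measure lebesgue N"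
      using measure_Un_le[of "T - N" lebesgue N] T NL \<open>T = (T - N) \<union> N\<close> by (metis fmeasurableD)
    moreover have "measure lebesgue (T - N) < \<delta>"
      using T(3,4) \<open>\<delta> > 0\<close> by (simp add: emeasure_eq_measure2 ennreal_less_iff)
    ultimately have T\<delta>: "measure lebesgue T < \<delta>" using NL by simp
    have "\<exists>d>0. (x \<in> N \<longrightarrow> ball x d \<subseteq> T) \<and> (x \<in> {a..b} - N \<longrightarrow>
         (\<forall>y\<in>{a..b}. norm (y-x) < d \<longrightarrow> norm (f y - f x - (y-x) *\<^sub>R f' x) \<le> e2 * norm (y-x)))" for x
    proof (cases "x \<in> N")
      case True
      then show ?thesis using T by (meson DiffD2 open_contains_ball_eq subsetD)
    next
      case False
      then show ?thesis
        using der[of x] e2 unfolding has_vector_derivative_def has_derivative_within_alt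
        by (cases "x \<in> {a..b}") (auto intro: exI[of _ 1])
    qed
    then obtain d where d: "\<And>x. 0 < d x" "\<And>x. x \<in> N \<Longrightarrow> ball x (d x) \<subseteq> T"
         "\<And>x y. \<lbrakk>x \<in> {a..b} - N; y \<in> {a..b}; norm (y-x) < d x\<rbrakk>
           \<Longrightarrow> norm (f y - f x - (y-x) *\<^sub>R f' x) \<le> e2 * norm (y-x)"
      by metis
    show "\<exists>d. gauge d \<and> (\<forall>p. p tagged_division_of (cbox a b) \<and> d fine p \<longrightarrow>
      norm ((\<Sum>(x, k)\<in>p. measure lborel k *\<^sub>R g x) - (f b - f a)) \<le> e * measure lborel (cbox a b))"
    proof (rule exI, safe)
      show "gauge (\<lambda>x. ball x (d x))"
        using d(1) gauge_ball_dependent by blast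
    next
      fix p
      assume ptag: "p tagged_division_of cbox a b" and finep: "(\<lambda>x. ball x (d x)) fine p"
      have fin: "finite p" using ptag by blast
      have iv: "\<exists>u v. K = {u..v} \<and> u \<le> v \<and> a \<le> u \<and> v \<le> b \<and> x \<in> K \<and> K \<subseteq> ball x (d x)"
        if "(x,K) \<in> p" for x K
      proof -
        have "x \<in> K" "K \<subseteq> cbox a b" "\<exists>u v. K = cbox u v" using ptag that by blast+
        moreover have "K \<subseteq> ball x (d x)" using finep that by blast
        ultimately show ?thesis by (auto simp: subset_iff)
      qed
      have fba: "f b - f a = (\<Sum>(x,K)\<in>p. f(Sup K) - f(Inf K))" and
           ba: "b - a = (\<Sum>(x,K)\<in>p. Sup K - Inf K)"
        using additive_tagged_division_1[where f= "\<lambda>x. x"] additive_tagged_division_1[where f= f]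
            \<open>a \<le> b\<close> ptag by auto
      define P where "P = {xK \<in> p. fst xK \<in> N}"
      have "P \<subseteq> p" "finite P" using fin by (auto simp: P_def)
      have good: "norm (measure lborel K *\<^sub>R g x - (f (Sup K) - f (Inf K))) \<le> e2 * (Sup K - Inf K)"
        if "(x,K) \<in> p - P" for x K
      proof -
        have xN: "x \<notin> N" and xKp: "(x,K) \<in> p" using that by (auto simp: P_def)
        obtain u v where K: "K = {u..v}" "u \<le> v" "a \<le> u" "v \<le> b" "x \<in> K" "K \<subseteq> ball x (d x)"
          using iv[OF xKp] by blast
        have xab: "x \<in> {a..b} - N" using K xN by auto
        have uv: "u \<in> ball x (d x)" "v \<in> ball x (d x)" using K subsetD[OF K(6), of u] subsetD[OF K(6), of v] by simp_all
        have "norm ((v - u) *\<^sub>R f' x - (f v - f u)) = norm (f u - f x - (u - x) *\<^sub>R f' x - (f v - f x - (v - x) *\<^sub>R f' x))"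
          by (auto simp: algebra_simps)
        also have "\<dots> \<le> norm (f u - f x - (u - x) *\<^sub>R f' x) + norm (f v - f x - (v - x) *\<^sub>R f' x)"
          by (rule norm_triangle_ineq4)
        also have "\<dots> \<le> e2 * norm (u - x) + e2 * norm (v - x)"
          using uv K by (intro add_mono d(3)[OF xab]) (auto simp: dist_real_def)
        also have "\<dots> = e2 * (v - u)" using K by (auto simp: algebra_simps)
        finally show ?thesis using K xN by (simp add: g_def)
      qed
      have bad: "(\<Sum>(x,K)\<in>P. norm (f (Sup K) - f (Inf K))) < e2 * (b - a)"
      proof -
        obtain h where h: "bij_betw h {0..<card P} P"
          using ex_bij_betw_nat_finite[OF \<open>finite P\<close>] by blast
        then have h: "bij_betw h {..<card P} P" by (simp add: atLeast0LessThan)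
        define u where "u i = Inf (snd (h i))" for i
        define v where "v i = Sup (snd (h i))" for i
        have hp: "h i \<in> P" if "i < card P" for i using h that by (auto simp: bij_betw_def)
        have snd: "snd (h i) = {u i..v i} \<and> u i \<le> v i \<and> a \<le> u i \<and> v i \<le> b \<and> {u i..v i} \<subseteq> T" if "i < card P" for i
        proof -
          obtain x K where xK: "h i = (x,K)" by fastforce
          with hp[OF that] have "(x,K) \<in> p" "x \<in> N" by (auto simp: P_def)
          from iv[OF this(1)] d(2)[OF this(2)] xK show ?thesis by (auto simp: u_def v_def)
        qed
        have disj: "{u i<..<v i} \<inter> {u j<..<v j} = {}" if "i < card P" "j < card P" "i \<noteq> j" for i j
        proof -
          have "h i \<noteq> h j" using h that by (auto simp: bij_betw_def inj_on_def)
          moreover have "h i \<in> p" "h j \<in> p" using hp that \<open>P \<subseteq> p\<close> by auto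
          ultimately have "interior (snd (h i)) \<inter> interior (snd (h j)) = {}"
            using tagged_division_ofD(5)[OF ptag, of "fst (h i)" "snd (h i)" "fst (h j)" "snd (h j)"] by auto
          then show ?thesis using snd that by (auto simp: interior_atLeastAtMost_real)
        qed
        have "(\<Sum>i<card P. v i - u i) = (\<Sum>i<card P. measure lebesgue {u i<..<v i})"
          using snd by (intro sum.cong) auto
        also have "\<dots> = measure lebesgue (\<Union>i<card P. {u i<..<v i})"
          using disj by (intro measure_UNION'[symmetric]) (auto simp: pairwise_def disjnt_def)
        also have "\<dots> \<le> measure lebesgue T"
        proof (rule measure_mono_fmeasurable)
          show "(\<Union>i<card P. {u i<..<v i}) \<subseteq> T"
          proof (rule UN_least)
            fix i assume "i \<in> {..<card P}"
            then show "{u i<..<v i} \<subseteq> T" using snd[of i] greaterThanLessThan_subseteq_atLeastAtMost_iff[of "u i" "v i" "u i" "v i"] by blast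
          qed
        qed (use TL in auto)
        finally have "(\<Sum>i<card P. v i - u i) < \<delta>" using T\<delta> by simp
        with \<delta>[of "card P" u v] snd disj have "(\<Sum>i<card P. norm (f (v i) - f (u i))) < e2 * (b - a)"
          by (auto simp: disjoint_family_on_def)
        also have "(\<Sum>i<card P. norm (f (v i) - f (u i))) = (\<Sum>xK\<in>P. norm (f (Sup (snd xK)) - f (Inf (snd xK))))"
          unfolding u_def v_def by (rule sum.reindex_bij_betw[OF h])
        finally show ?thesis by (simp add: case_prod_unfold)
      qed
      have "(\<Sum>(x, k)\<in>p. measure lborel k *\<^sub>R g x) - (f b - f a) = (\<Sum>(x,K)\<in>p. measure lborel K *\<^sub>R g x - (f (Sup K) - f (Inf K)))"
        by (simp add: fba sum_subtractf case_prod_unfold)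
      also have "\<dots> = (\<Sum>(x,K)\<in>p-P. measure lborel K *\<^sub>R g x - (f (Sup K) - f (Inf K)))
          + (\<Sum>(x,K)\<in>P. measure lborel K *\<^sub>R g x - (f (Sup K) - f (Inf K)))"
        using sum.subset_diff[OF \<open>P \<subseteq> p\<close> fin] .
      also have "norm \<dots> \<le> (\<Sum>(x,K)\<in>p-P. e2 * (Sup K - Inf K)) + (\<Sum>(x,K)\<in>P. norm (f (Sup K) - f (Inf K)))"
      proof (rule norm_triangle_mono)
        show "norm (\<Sum>(x,K)\<in>p-P. measure lborel K *\<^sub>R g x - (f (Sup K) - f (Inf K))) \<le> (\<Sum>(x,K)\<in>p-P. e2 * (Sup K - Inf K))"
          using good by (intro sum_norm_le) auto
        show "norm (\<Sum>(x,K)\<in>P. measure lborel K *\<^sub>R g x - (f (Sup K) - f (Inf K))) \<le> (\<Sum>(x,K)\<in>P. norm (f (Sup K) - f (Inf K)))"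
          by (intro sum_norm_le) (auto simp: P_def g_def norm_minus_commute)
      qed
      also have "\<dots> \<le> (\<Sum>(x,K)\<in>p. e2 * (Sup K - Inf K)) + e2 * (b - a)"
      proof (intro add_mono sum_mono2)
        show "0 \<le> (case xK of (x,K) \<Rightarrow> e2 * (Sup K - Inf K))" if "xK \<in> p - (p - P)" for xK
          using that iv[of "fst xK" "snd xK"] e2 by (auto simp: case_prod_unfold)
      qed (use fin bad in auto)
      also have "(\<Sum>(x,K)\<in>p. e2 * (Sup K - Inf K)) = e2 * (b - a)"
        by (simp add: ba sum_distrib_left case_prod_unfold)
      also have "e2 * (b - a) + e2 * (b - a) = e * measure lborel (cbox a b)"
        using \<open>a < b\<close> by (simp add: e2_def field_simps)
      finally show "norm ((\<Sum>(x, k)\<in>p. measure lborel k *\<^sub>R g x) - (f b - f a)) \<le> e * measure lborel (cbox a b)" .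
    qed
  qed
  then show ?thesis by (rule has_integral_spike[OF N, rotated]) (auto simp: g_def)
qed (simp add: has_integral_refl)

text \<open>
  Lebesgue's differentiation theorem on the line. If the difference quotients at \<open>x\<close> do not
  converge to \<open>v x\<close>, there are arbitrarily short intervals with end point \<open>x\<close> on which the
  Riemann term and the integral differ by at least a fixed multiple of the length. By Vitali,
  disjoint intervals of this kind cover almost all such \<open>x\<close>, and by Henstock's lemma their total
  length is arbitrarily small.
\<close>

lemma negligible_not_indefinite_integral_derivative:
  fixes v :: "real \<Rightarrow> 'a::euclidean_space"
  assumes v: "v integrable_on {a..b}"
  shows "negligible {x \<in> {a..b}. \<not> ((\<lambda>t. integral {a..t} v) has_vector_derivative v x) (at x within {a..b})}"
proof -
  define F where "F t = integral {a..t} v" for t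
  \<comment> \<open>Points near which the difference quotient misses \<open>v x\<close> by more than \<open>1 / (n + 1)\<close>.\<close>
  define E where "E n = {x \<in> {a..b}. \<forall>d>0. \<exists>y\<in>{a..b}. y \<noteq> x \<and> \<bar>y - x\<bar> < d \<and>
      norm (F y - F x - (y - x) *\<^sub>R v x) > \<bar>y - x\<bar> / (real n + 1)}" for n :: nat
  have diff: "integral {x..y} v = F y - F x" if "a \<le> x" "x \<le> y" "y \<le> b" for x y
    using Henstock_Kurzweil_Integration.integral_combine[of a x y v] integrable_on_subinterval[OF v, of a y] that
    by (simp add: F_def algebra_simps)
  have "negligible (E n)" for n
    unfolding negligible_outer_le
  proof safe
    fix e :: real assume "e > 0"
    define m where "m = real n + 1"
    have m: "m > 0" by (simp add: m_def)
    define e' where "e' = e / m"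
    have "e' > 0" using \<open>e > 0\<close> m by (simp add: e'_def)
    have "v integrable_on cbox a b" using v by simp
    from Henstock_lemma[OF this \<open>e' > 0\<close>] obtain \<gamma> where \<gamma>: "gauge \<gamma>" and
      \<gamma>e: "\<And>p. \<lbrakk>p tagged_partial_division_of (cbox a b); \<gamma> fine p\<rbrakk> \<Longrightarrow>
             (\<Sum>(x,k)\<in>p. norm (measure lborel k *\<^sub>R v x - integral k v)) < e'" by blast
    \<comment> \<open>The interval between \<open>x\<close> and \<open>y\<close>, written as a ball for the sake of Vitali's theorem; \<open>x\<close> is its tag.\<close>
    define I where "I xy = cball ((fst xy + snd xy) / 2) (\<bar>snd xy - fst xy\<bar> / 2)" for xy :: "real \<times> real"
    have I: "I (x,y) = {min x y..max x y}" for x y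
      by (auto simp: I_def cball_def dist_real_def min_def max_def field_simps abs_if split: if_splits)
    define K where "K = {(x,y). x \<in> {a..b} \<and> y \<in> {a..b} \<and> y \<noteq> x \<and> I (x,y) \<subseteq> \<gamma> x \<and>
        norm (F y - F x - (y - x) *\<^sub>R v x) > \<bar>y - x\<bar> / m}"
    have "\<exists>i. i \<in> K \<and> x \<in> cball ((fst i + snd i) / 2) (\<bar>snd i - fst i\<bar> / 2) \<and> \<bar>snd i - fst i\<bar> / 2 < d"
      if "x \<in> E n" "0 < d" for x d
    proof -
      obtain r where r: "r > 0" "ball x r \<subseteq> \<gamma> x"
        using \<gamma> by (meson gauge_def open_contains_ball_eq)
      have "min r d > 0" using r that by simp
      with that(1) obtain y where y: "y \<in> {a..b}" "y \<noteq> x" "\<bar>y - x\<bar> < min r d"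
        "norm (F y - F x - (y - x) *\<^sub>R v x) > \<bar>y - x\<bar> / m" and "x \<in> {a..b}"
        unfolding E_def m_def by blast
      have "I (x,y) \<subseteq> ball x r" using y unfolding I by (auto simp: dist_real_def)
      with r y \<open>x \<in> {a..b}\<close> have "(x,y) \<in> K" by (auto simp: K_def)
      moreover have "x \<in> I (x,y)" by (simp add: I)
      moreover have "\<bar>y - x\<bar> / 2 < d" using y(3) \<open>0 < d\<close> by simp
      ultimately show ?thesis unfolding I_def
        by (intro exI[of _ "(x,y)"] conjI) simp_all
    qed
    note cov = this
    have pos: "0 < \<bar>snd i - fst i\<bar> / 2" if "i \<in> K" for i
      using that by (auto simp: K_def)
    obtain C where "countable C" "C \<subseteq> K"
       "pairwise (\<lambda>i j. disjnt (cball ((fst i + snd i) / 2) (\<bar>snd i - fst i\<bar> / 2))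
                               (cball ((fst j + snd j) / 2) (\<bar>snd j - fst j\<bar> / 2))) C"
       "negligible (E n - (\<Union>i\<in>C. cball ((fst i + snd i) / 2) (\<bar>snd i - fst i\<bar> / 2)))"
      by (rule Vitali_covering_theorem_cballs[OF pos cov])
    then have C: "countable C" "C \<subseteq> K" "pairwise (\<lambda>i j. disjnt (I i) (I j)) C"
       and neg: "negligible (E n - (\<Union>i\<in>C. I i))"
      unfolding I_def by blast+
    have bound: "measure lebesgue (\<Union>i\<in>J. I i) \<le> e" if J: "J \<subseteq> C" "finite J" for J
    proof -
      define p where "p = (\<lambda>i. (fst i, I i)) ` J"
      have JK: "J \<subseteq> K" using J C by auto
      have pw: "I i \<inter> I j = {}" if "i \<in> J" "j \<in> J" "i \<noteq> j" for i j
        using C(3) that J unfolding pairwise_def disjnt_def by blast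
      have ne: "fst i \<in> I i" for i using I[of "fst i" "snd i"] by simp
      have inj: "inj_on (\<lambda>i. (fst i, I i)) J"
        using pw ne unfolding inj_on_def by blast
      have "p tagged_partial_division_of (cbox a b)"
        unfolding tagged_partial_division_of_def
      proof (intro conjI allI impI)
        fix x L assume xL: "(x, L) \<in> p"
        then obtain y where xy: "(x,y) \<in> J" "L = I (x,y)" by (auto simp: p_def)
        with JK have "x \<in> {a..b}" "y \<in> {a..b}" by (auto simp: K_def)
        with xy I show "x \<in> L" "L \<subseteq> cbox a b" "\<exists>a b. L = cbox a b" by auto
      next
        fix x1 k1 x2 k2 assume as: "(x1, k1) \<in> p \<and> (x2, k2) \<in> p \<and> (x1, k1) \<noteq> (x2, k2)"
        then obtain i j where "i \<in> J" "j \<in> J" "k1 = I i" "k2 = I j" "i \<noteq> j" by (auto simp: p_def)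
        with pw[of i j] show "interior k1 \<inter> interior k2 = {}" using interior_subset by blast
      qed (use J in \<open>auto simp: p_def\<close>)
      moreover have "\<gamma> fine p" using JK by (force simp: p_def fine_def K_def)
      ultimately have "(\<Sum>(x,k)\<in>p. norm (measure lborel k *\<^sub>R v x - integral k v)) < e'" by (rule \<gamma>e)
      then have le: "(\<Sum>i\<in>J. norm (measure lborel (I i) *\<^sub>R v (fst i) - integral (I i) v)) < e'"
        unfolding p_def by (simp add: sum.reindex[OF inj] case_prod_unfold)
      have each: "measure lebesgue (I i) \<le> m * norm (measure lborel (I i) *\<^sub>R v (fst i) - integral (I i) v)" if i: "i \<in> J" for i
      proof -
        obtain x y where ixy: "i = (x,y)" by fastforce
        with i JK have xy: "x \<in> {a..b}" "y \<in> {a..b}" "y \<noteq> x"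
           "norm (F y - F x - (y - x) *\<^sub>R v x) > \<bar>y - x\<bar> / m" by (auto simp: K_def)
        have "norm (measure lborel (I i) *\<^sub>R v (fst i) - integral (I i) v) = norm (F y - F x - (y - x) *\<^sub>R v x)"
        proof (cases "x \<le> y")
          case True
          then show ?thesis using xy diff[of x y] by (simp add: ixy I min_def max_def norm_minus_commute)
        next
          case False
          then have "integral (I i) v = F x - F y" "measure lborel (I i) = x - y"
            using xy diff[of y x] by (simp_all add: ixy I min_def max_def)
          moreover have "(x - y) *\<^sub>R v x - (F x - F y) = F y - F x - (y - x) *\<^sub>R v x"
            by (simp add: algebra_simps)
          ultimately show ?thesis unfolding ixy fst_conv by (simp only:)
        qed
        moreover have "measure lebesgue (I i) = \<bar>y - x\<bar>" by (simp add: ixy I min_def max_def)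
        ultimately show ?thesis using xy m by (simp add: field_simps)
      qed
      have "measure lebesgue (\<Union>i\<in>J. I i) \<le> (\<Sum>i\<in>J. measure lebesgue (I i))"
        by (rule measure_UNION_le) (use J in \<open>auto simp: I_def\<close>)
      also have "\<dots> \<le> (\<Sum>i\<in>J. m * norm (measure lborel (I i) *\<^sub>R v (fst i) - integral (I i) v))"
        by (rule sum_mono[OF each])
      also have "\<dots> \<le> m * e'" using le m by (simp add: sum_distrib_left[symmetric])
      also have "\<dots> = e" using m by (simp add: e'_def)
      finally show ?thesis .
    qed
    have IL: "I i \<in> lmeasurable" for i by (simp add: I_def)
    have U: "(\<Union>i\<in>C. I i) \<in> lmeasurable"
      using fmeasurable_UN_bound[OF \<open>countable C\<close> IL bound] by blast
    have Um: "measure lebesgue (\<Union>i\<in>C. I i) \<le> e"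
      using measure_UN_bound[OF \<open>countable C\<close> IL bound] by blast
    let ?T = "(E n - (\<Union>i\<in>C. I i)) \<union> (\<Union>i\<in>C. I i)"
    have NL: "E n - (\<Union>i\<in>C. I i) \<in> lmeasurable" "measure lebesgue (E n - (\<Union>i\<in>C. I i)) = 0"
      using neg unfolding negligible_iff_measure by blast+
    have "measure lebesgue ?T \<le> e"
      using measure_Un_le[OF fmeasurableD[OF NL(1)] fmeasurableD[OF U]] NL(2) Um by linarith
    moreover have "?T \<in> lmeasurable" by (rule fmeasurable.Un[OF NL(1) U])
    moreover have "E n \<subseteq> ?T" by blast
    ultimately show "\<exists>T. E n \<subseteq> T \<and> T \<in> lmeasurable \<and> measure lebesgue T \<le> e"
      by (intro exI[of _ ?T] conjI)
  qed
  then have "negligible (\<Union>n. E n)" by (rule negligible_Union_nat)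
  then show ?thesis
  proof (rule negligible_subset, safe)
    fix x assume x: "x \<in> {a..b}" and nd: "\<not> ((\<lambda>t. integral {a..t} v) has_vector_derivative v x) (at x within {a..b})"
    then have "\<not> (\<forall>e>0. \<exists>d>0. \<forall>y\<in>{a..b}. norm (y-x) < d \<longrightarrow> norm (F y - F x - (y-x) *\<^sub>R v x) \<le> e * norm (y-x))"
      unfolding has_vector_derivative_def has_derivative_within_alt F_def
      by (auto simp: bounded_linear_scaleR_left)
    then obtain e where "e > 0" and e: "\<And>d. d > 0 \<Longrightarrow> \<exists>y\<in>{a..b}. norm (y-x) < d \<and> \<not> norm (F y - F x - (y-x) *\<^sub>R v x) \<le> e * norm (y-x)"
      by blast
    obtain n where n: "inverse (real (Suc n)) < e" using reals_Archimedean[OF \<open>e > 0\<close>] by blast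
    have "x \<in> E n" unfolding E_def
    proof (safe intro!: x)
      fix d :: real assume "d > 0"
      from e[OF this] obtain y where y: "y \<in> {a..b}" "norm (y-x) < d" "\<not> norm (F y - F x - (y-x) *\<^sub>R v x) \<le> e * norm (y-x)"
        by blast
      have "y \<noteq> x" using y by auto
      moreover have "\<bar>y - x\<bar> / (real n + 1) \<le> e * norm (y-x)"
        using mult_right_mono[of "inverse (real (Suc n))" e "\<bar>y - x\<bar>"] n by (simp add: field_simps)
      ultimately show "\<exists>y\<in>{a..b}. y \<noteq> x \<and> \<bar>y - x\<bar> < d \<and> \<bar>y - x\<bar> / (real n + 1) < norm (F y - F x - (y - x) *\<^sub>R v x)"
        using y by (intro bexI[of _ y]) auto
    qed
    then show "x \<in> (\<Union>n. E n)" by blast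
  qed
qed

text \<open>
  Absolute continuity of the integral: \<open>k\<close> is split into its truncation at a large level,
  whose integral is controlled by the length, and a remainder with small integral.
\<close>

lemma abs_continuous_integral_bound:
  fixes F :: "real \<Rightarrow> 'a::real_normed_vector" and k :: "real \<Rightarrow> real"
  assumes k: "k integrable_on {a..b}" and k0: "\<And>x. x \<in> {a..b} \<Longrightarrow> 0 \<le> k x"
    and F: "\<And>u v. a \<le> u \<Longrightarrow> u \<le> v \<Longrightarrow> v \<le> b \<Longrightarrow> norm (F v - F u) \<le> integral {u..v} k"
  shows "abs_continuous_on_interval a b F"
  unfolding abs_continuous_on_interval_def
proof safe
  fix e :: real assume "e > 0"
  \<comment> \<open>The part of \<open>k\<close> above the level \<open>n\<close>.\<close>
  define h where "h n x = k x - min (k x) (real n)" for n x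
  have kabs: "k absolutely_integrable_on {a..b}"
    using k k0 nonnegative_absolutely_integrable_1 by blast
  have hint: "h n integrable_on {a..b}" for n
    unfolding h_def
    by (intro integrable_diff k set_lebesgue_integral_eq_integral(1) absolutely_integrable_min_1 kabs) simp
  have "(\<lambda>n. integral {a..b} (h n)) \<longlonglongrightarrow> integral {a..b} (\<lambda>x. 0)"
  proof (rule dominated_convergence(2)[OF hint k])
    fix x assume "x \<in> {a..b}"
    show "norm (h n x) \<le> k x" for n using k0[OF \<open>x \<in> {a..b}\<close>] by (auto simp: h_def)
    have "eventually (\<lambda>n. h n x = 0) sequentially"
      using eventually_ge_at_top[of "nat \<lceil>k x\<rceil>"]
    proof eventually_elim
      case (elim n)
      then have "k x \<le> real n" by linarith
      then show ?case by (simp add: h_def)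
    qed
    then show "(\<lambda>n. h n x) \<longlonglongrightarrow> 0" by (rule tendsto_eventually)
  qed
  then have "eventually (\<lambda>n. integral {a..b} (h n) < e / 2) sequentially"
    using \<open>e > 0\<close> by (intro order_tendstoD(2)[of _ 0]) auto
  then obtain n where n: "integral {a..b} (h n) < e / 2" by (auto simp: eventually_sequentially)
  define \<delta> where "\<delta> = e / (2 * (real n + 1))"
  have \<delta>: "\<delta> > 0" "real n * \<delta> \<le> e / 2" using \<open>e > 0\<close> by (auto simp: \<delta>_def field_simps)
  show "\<exists>\<delta>>0. \<forall>(m::nat) u v. (\<forall>i<m. a \<le> u i \<and> u i \<le> v i \<and> v i \<le> b) \<longrightarrow>
        disjoint_family_on (\<lambda>i. {u i<..<v i}) {..<m} \<longrightarrow>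
        (\<Sum>i<m. v i - u i) < \<delta> \<longrightarrow> (\<Sum>i<m. norm (F (v i) - F (u i))) < e"
  proof (intro exI[of _ \<delta>] conjI allI impI \<delta>(1))
    fix m :: nat and u v :: "nat \<Rightarrow> real"
    assume uv: "\<forall>i<m. a \<le> u i \<and> u i \<le> v i \<and> v i \<le> b" and disj: "disjoint_family_on (\<lambda>i. {u i<..<v i}) {..<m}"
      and len: "(\<Sum>i<m. v i - u i) < \<delta>"
    have hi: "h n integrable_on {u i..v i}" if "i < m" for i
      using integrable_on_subinterval[OF hint] uv that by simp
    have ki: "k integrable_on {u i..v i}" if "i < m" for i
      using integrable_on_subinterval[OF k] uv that by simp
    have step: "norm (F (v i) - F (u i)) \<le> integral {u i..v i} (h n) + real n * (v i - u i)" if "i < m" for i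
    proof -
      have "norm (F (v i) - F (u i)) \<le> integral {u i..v i} k" using F uv that by blast
      also have "\<dots> \<le> integral {u i..v i} (\<lambda>x. h n x + real n)"
        using ki[OF that] hi[OF that] by (intro integral_le integrable_add) (auto simp: h_def[abs_def])
      also have "\<dots> = integral {u i..v i} (h n) + real n * (v i - u i)"
        using hi[OF that] uv that by (subst integral_add) auto
      finally show ?thesis .
    qed
    have "negligible ({u i..v i} \<inter> {u j..v j})" if "i < m" "j < m" "i \<noteq> j" for i j
    proof (rule negligible_subset[of "{u i, v i, u j, v j}"])
      have "{u i<..<v i} \<inter> {u j<..<v j} = {}" using disj that by (auto simp: disjoint_family_on_def)
      then show "{u i..v i} \<inter> {u j..v j} \<subseteq> {u i, v i, u j, v j}"
        by (simp add: set_eq_iff subset_iff) (metis order_less_le)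
    qed auto
    then have "((h n) has_integral (\<Sum>i<m. integral {u i..v i} (h n))) (\<Union>i<m. {u i..v i})"
      using hi by (intro has_integral_UN) (auto simp: pairwise_def)
    then have "(\<Sum>i<m. integral {u i..v i} (h n)) = integral (\<Union>i<m. {u i..v i}) (h n)"
      and "h n integrable_on (\<Union>i<m. {u i..v i})"
      by (auto simp: has_integral_iff)
    moreover have "integral (\<Union>i<m. {u i..v i}) (h n) \<le> integral {a..b} (h n)"
      by (rule integral_subset_le[OF _ _ hint]) (use uv calculation in \<open>force simp: h_def\<close>)+
    ultimately have "(\<Sum>i<m. integral {u i..v i} (h n)) < e / 2" using n by linarith
    moreover have "real n * (\<Sum>i<m. v i - u i) \<le> e / 2"
      using mult_left_mono[OF less_imp_le[OF len], of "real n"] \<delta>(2) by linarith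
    moreover have "(\<Sum>i<m. norm (F (v i) - F (u i))) \<le> (\<Sum>i<m. integral {u i..v i} (h n) + real n * (v i - u i))"
      using step by (intro sum_mono) auto
    ultimately show "(\<Sum>i<m. norm (F (v i) - F (u i))) < e"
      by (simp add: sum.distrib sum_distrib_left)
  qed
qed

text \<open>
  A function with derivative zero is constant, in a form that avoids derivatives: the
  increments over a fine equidistant partition are summed up. In the application \<open>G\<close> is an
  indefinite integral, so that a step may be large where the integrand is.
\<close>

lemma equal_endpoints_if_infinitesimal_increments:
  fixes F :: "real \<Rightarrow> 'a::real_normed_vector" and G :: "real \<Rightarrow> real"
  assumes "a \<le> b"
    and step: "\<And>\<epsilon>. \<epsilon> > 0 \<Longrightarrow> \<exists>\<delta>>0. \<forall>s t. a \<le> s \<longrightarrow> s \<le> t \<longrightarrow> t \<le> b \<longrightarrow> t - s < \<delta> \<longrightarrow>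
                 norm (F t - F s) \<le> \<epsilon> * (G t - G s)"
  shows "F b = F a"
proof -
  have "norm (F b - F a) \<le> \<epsilon> * (G b - G a)" if \<epsilon>: "\<epsilon> > 0" for \<epsilon>
  proof -
    obtain \<delta> where "\<delta> > 0" and \<delta>: "\<And>s t. a \<le> s \<Longrightarrow> s \<le> t \<Longrightarrow> t \<le> b \<Longrightarrow> t - s < \<delta> \<Longrightarrow>
                 norm (F t - F s) \<le> \<epsilon> * (G t - G s)" using step[OF \<epsilon>] by blast
    obtain n :: nat where n: "(b - a) / \<delta> < real n" "n > 0"
    proof -
      obtain n :: nat where n: "(b - a) / \<delta> < real n" using reals_Archimedean2 by blast
      moreover have "0 \<le> (b - a) / \<delta>" using \<open>a \<le> b\<close> \<open>\<delta> > 0\<close> by simp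
      ultimately have "n > 0" by (cases n) auto
      with n show ?thesis by (rule that)
    qed
    define t where "t i = a + real i * ((b - a) / real n)" for i
    have t0: "t 0 = a" "t n = b" using n by (auto simp: t_def)
    have tmono: "t i \<le> t j" if "i \<le> j" for i j
      using that \<open>a \<le> b\<close> unfolding t_def by (intro add_left_mono mult_right_mono) auto
    have dt: "t (Suc i) - t i = (b - a) / real n" for i
    proof -
      have "t (Suc i) - t i = (real (Suc i) - real i) * ((b - a) / real n)"
        unfolding t_def by (simp only: left_diff_distrib add_diff_cancel_left)
      then show ?thesis by simp
    qed
    have "(b - a) / real n < \<delta>" using n \<open>\<delta> > 0\<close> by (simp add: field_simps)
    have "F b - F a = (\<Sum>i<n. F (t (Suc i)) - F (t i))"
      using sum_lessThan_telescope[of "\<lambda>i. F (t i)" n] t0 by simp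
    also have "norm \<dots> \<le> (\<Sum>i<n. \<epsilon> * (G (t (Suc i)) - G (t i)))"
    proof (rule sum_norm_le)
      fix i assume "i \<in> {..<n}"
      then show "norm (F (t (Suc i)) - F (t i)) \<le> \<epsilon> * (G (t (Suc i)) - G (t i))"
        using tmono[of 0 i] tmono[of "Suc i" n] tmono[of i "Suc i"] t0 dt[of i] \<open>(b - a) / real n < \<delta>\<close>
        by (intro \<delta>) auto
    qed
    also have "\<dots> = \<epsilon> * (G b - G a)"
      using sum_lessThan_telescope[of "\<lambda>i. G (t i)" n] t0 by (simp add: sum_distrib_left[symmetric])
    finally show ?thesis .
  qed
  note * = this
  have "norm (F b - F a) \<le> 0"
  proof (rule ccontr)
    assume as: "\<not> norm (F b - F a) \<le> 0"
    define M where "M = \<bar>G b - G a\<bar> + 1"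
    have "M > 0" "G b - G a < M" by (auto simp: M_def)
    with as have "norm (F b - F a) / M * (G b - G a) < norm (F b - F a) / M * M"
      by (intro mult_strict_left_mono) auto
    then show False using *[of "norm (F b - F a) / M"] as \<open>M > 0\<close> by auto
  qed
  then show ?thesis by simp
qed

section \<open>Holomorphic maps of a half-plane\<close>

lemma open_half_plane: "open (half_plane c)"
  unfolding half_plane_def by (rule open_halfspace_Re_gt)

lemma mem_half_plane [simp]: "z \<in> half_plane c \<longleftrightarrow> c < Re z"
  by (simp add: half_plane_def)

text \<open>
  The identity behind the Cayley transform \<open>(z - w) / (z + cnj w)\<close>: it expresses the
  denominator by the numerator and the two distances from the boundary.
\<close>

lemma cmod_add_cnj_power2: "(cmod (z + cnj w))\<^sup>2 = (cmod (z - w))\<^sup>2 + 4 * (Re z * Re w)"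
  unfolding cmod_power2 by (simp add: power2_eq_square algebra_simps)

text \<open>
  Conjugation with the Cayley transforms that take \<open>w\<close> and \<open>f w\<close> to \<open>0\<close> reduces this to
  the Schwarz lemma in the unit disk. In this form the hyperbolic distance is
  replaced by \<open>|z - w|^2 / (Re z * Re w)\<close>, an increasing function of it.
\<close>

lemma schwarz_pick_half_plane:
  assumes hol: "f holomorphic_on right_half_plane"
    and pos: "\<And>z. 0 < Re z \<Longrightarrow> 0 < Re (f z)"
    and z: "0 < Re z" and w: "0 < Re w"
  shows "(cmod (f z - f w))\<^sup>2 * (Re z * Re w) \<le> (cmod (z - w))\<^sup>2 * (Re (f z) * Re (f w))"
proof -
  define T where "T c z = (z - c) / (z + cnj c)" for c z :: complex
  define S where "S c \<zeta> = (c + \<zeta> * cnj c) / (1 - \<zeta>)" for c \<zeta> :: complex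
  have ne: "z + cnj c \<noteq> 0" if "0 < Re z" "0 < Re c" for z c
    using that by (auto simp: complex_eq_iff)
  have T2: "(cmod (T c z))\<^sup>2 = (cmod (z - c))\<^sup>2 / ((cmod (z - c))\<^sup>2 + 4 * (Re z * Re c))" for c z
    unfolding T_def norm_divide power_divide cmod_add_cnj_power2 ..
  have T1: "cmod (T c z) < 1" if "0 < Re z" "0 < Re c" for z c
  proof -
    have "(cmod (T c z))\<^sup>2 < 1\<^sup>2"
      unfolding T2 using that by (simp add: divide_less_eq add_nonneg_pos)
    then show ?thesis using power2_less_imp_less by fastforce
  qed
  have Spos: "0 < Re (S c \<zeta>)" if "0 < Re c" "cmod \<zeta> < 1" for c \<zeta>
  proof -
    have "\<zeta> \<noteq> 1" using that by auto
    have "(cmod \<zeta>)\<^sup>2 < 1" using that by (simp add: abs_square_less_1)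
    have "Re ((c + \<zeta> * cnj c) * cnj (1 - \<zeta>)) = Re c * (1 - (cmod \<zeta>)\<^sup>2)"
      unfolding cmod_power2 by (simp add: power2_eq_square algebra_simps)
    also have "\<dots> > 0" using that \<open>(cmod \<zeta>)\<^sup>2 < 1\<close> by simp
    finally show ?thesis
      unfolding S_def complex_div_cnj[of _ "1 - \<zeta>"] using \<open>\<zeta> \<noteq> 1\<close>
      by (simp add: Re_divide_of_real flip: of_real_power)
  qed
  define F where "F = (\<lambda>\<zeta>. T (f w) (f (S w \<zeta>)))"
  have fw: "0 < Re (f w)" using pos w by blast
  have holF: "F holomorphic_on ball 0 1"
    unfolding F_def T_def
  proof (intro holomorphic_intros)
    have "S w holomorphic_on ball 0 1"
      unfolding S_def by (intro holomorphic_intros) auto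
    moreover have "S w ` ball 0 1 \<subseteq> right_half_plane" using Spos[OF w] by auto
    ultimately have "f \<circ> S w holomorphic_on ball 0 1"
      by (rule holomorphic_on_compose_gen[OF _ hol])
    then show "(\<lambda>\<zeta>. f (S w \<zeta>)) holomorphic_on ball 0 1" "(\<lambda>\<zeta>. f (S w \<zeta>)) holomorphic_on ball 0 1"
      by (simp_all add: o_def)
    show "f (S w \<zeta>) + cnj (f w) \<noteq> 0" if "\<zeta> \<in> ball 0 1" for \<zeta>
      using ne fw pos Spos[OF w] that by simp
  qed
  have F0: "F 0 = 0" by (simp add: F_def S_def T_def)
  have F1: "cmod (F \<zeta>) < 1" if "cmod \<zeta> < 1" for \<zeta>
    unfolding F_def using T1 pos Spos w that by blast
  have ST: "S w (T w z) = z"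
  proof -
    have nz: "z + cnj w \<noteq> 0" "w + cnj w \<noteq> 0" using ne z w by auto
    have "w + T w z * cnj w = z * (w + cnj w) / (z + cnj w)"
      using nz by (simp add: T_def divide_simps) (simp add: algebra_simps)
    moreover have "1 - T w z = (w + cnj w) / (z + cnj w)"
      using nz by (simp add: T_def divide_simps)
    ultimately show ?thesis unfolding S_def using nz by simp
  qed
  have "cmod (F (T w z)) \<le> cmod (T w z)"
    by (rule Schwarz_Lemma(1)[OF holF F0 F1 T1[OF z w]])
  then have "(cmod (T (f w) (f z)))\<^sup>2 \<le> (cmod (T w z))\<^sup>2"
    by (simp add: F_def ST power_mono)
  moreover define A A' B B' where "A = (cmod (z - w))\<^sup>2" "A' = (cmod (f z - f w))\<^sup>2"
    "B = Re z * Re w" "B' = Re (f z) * Re (f w)"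
  ultimately have "A' / (A' + 4 * B') \<le> A / (A + 4 * B)" by (simp add: T2)
  moreover have "A \<ge> 0" "A' \<ge> 0" "B > 0" "B' > 0"
    using z w pos by (auto simp: A_A'_B_B'_def)
  ultimately have "A' * (A + 4 * B) \<le> A * (A' + 4 * B')"
    by (simp add: divide_simps add_nonneg_pos split: if_splits)
  then have "A' * B \<le> A * B'" by (simp add: algebra_simps)
  then show ?thesis by (simp only: A_A'_B_B'_def)
qed

text \<open>
  The form in which Schwarz-Pick is used most: both for the field itself and for the maps
  of the flow. Bounding the real part just at the two points is what makes it applicable to the flow,
  whose real part is unbounded.
\<close>

lemma half_plane_map_lipschitz:
  assumes hol: "f holomorphic_on right_half_plane"
    and pos: "\<And>z. 0 < Re z \<Longrightarrow> 0 < Re (f z)"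
    and "0 < \<epsilon>" "\<epsilon> \<le> Re z" "\<epsilon> \<le> Re w"
    and C: "Re (f z) \<le> C" "Re (f w) \<le> C"
  shows "cmod (f z - f w) \<le> C / \<epsilon> * cmod (z - w)"
proof -
  have zw: "0 < Re z" "0 < Re w" using assms by auto
  have C0: "0 < C" using pos[OF zw(1)] C by auto
  have "(cmod (f z - f w) * \<epsilon>)\<^sup>2 = (cmod (f z - f w))\<^sup>2 * (\<epsilon> * \<epsilon>)"
    by (simp add: power2_eq_square)
  also have "\<dots> \<le> (cmod (f z - f w))\<^sup>2 * (Re z * Re w)"
    using assms by (intro mult_left_mono mult_mono) auto
  also have "\<dots> \<le> (cmod (z - w))\<^sup>2 * (Re (f z) * Re (f w))"
    using schwarz_pick_half_plane[OF hol pos zw] by blast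
  also have "\<dots> \<le> (cmod (z - w))\<^sup>2 * (C * C)"
    using pos[OF zw(1)] pos[OF zw(2)] C C0 by (intro mult_left_mono mult_mono) auto
  also have "\<dots> = (C * cmod (z - w))\<^sup>2" by (simp add: power2_eq_square)
  finally have "cmod (f z - f w) * \<epsilon> \<le> C * cmod (z - w)"
    by (rule power2_le_imp_le) (use C0 in auto)
  then show ?thesis using \<open>0 < \<epsilon>\<close> by (simp add: field_simps)
qed

text \<open>
  Differentiation under the integral sign. The bounded range makes the difference
  quotients near \<open>z\<close> uniformly bounded (by \<open>half_plane_map_lipschitz\<close>), which provides
  the majorant for dominated convergence.
\<close>

lemma holomorphic_integral_of_strip_maps:
  fixes F :: "complex \<Rightarrow> real \<Rightarrow> complex"
  assumes hol: "\<And>u. u \<in> {a..b} \<Longrightarrow> (\<lambda>z. F z u) holomorphic_on right_half_plane"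
    and strip: "\<And>z u. 0 < Re z \<Longrightarrow> u \<in> {a..b} \<Longrightarrow> 0 < Re (F z u) \<and> Re (F z u) < C"
    and int: "\<And>z. 0 < Re z \<Longrightarrow> F z integrable_on {a..b}"
  shows "(\<lambda>z. integral {a..b} (F z)) holomorphic_on right_half_plane"
  unfolding holomorphic_on_open[OF open_half_plane]
proof (intro ballI exI)
  fix z assume "z \<in> right_half_plane"
  then have z: "0 < Re z" by simp
  define \<epsilon> where "\<epsilon> = Re z / 2"
  have \<epsilon>: "\<epsilon> > 0" using z by (simp add: \<epsilon>_def)
  have near: "\<epsilon> \<le> Re w" if "w \<in> ball z \<epsilon>" for w
  proof -
    have "\<bar>Re (z - w)\<bar> < \<epsilon>" using that abs_Re_le_cmod[of "z - w"] by (simp add: dist_norm)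
    then have "Re z - Re w < \<epsilon>" by simp
    then show ?thesis by (simp add: \<epsilon>_def)
  qed
  show "((\<lambda>z. integral {a..b} (F z)) has_field_derivative integral {a..b} (\<lambda>u. deriv (\<lambda>z. F z u) z)) (at z)"
    unfolding has_field_derivative_iff
  proof (subst at_within_open[of z "ball z \<epsilon>", symmetric])
    show "((\<lambda>w. (integral {a..b} (F w) - integral {a..b} (F z)) / (w - z)) \<longlongrightarrow>
        integral {a..b} (\<lambda>u. deriv (\<lambda>z. F z u) z)) (at z within ball z \<epsilon>)"
      unfolding tendsto_at_iff_sequentially
    proof (intro allI impI)
      fix X assume X: "\<forall>i. X i \<in> ball z \<epsilon> - {z}" and lim: "X \<longlonglongrightarrow> z"
      have Xpos: "0 < Re (X i)" "\<epsilon> \<le> Re (X i)" "X i \<noteq> z" for i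
        using near[of "X i"] X \<epsilon> by fastforce+
      define g where "g i u = (F (X i) u - F z u) / (X i - z)" for i u
      have gint: "g i integrable_on {a..b}" for i
        unfolding g_def divide_inverse
        using int[OF Xpos(1)[of i]] int[OF z] by (intro integrable_on_mult_left integrable_diff)
      have "(\<lambda>i. integral {a..b} (g i)) \<longlonglongrightarrow> integral {a..b} (\<lambda>u. deriv (\<lambda>z. F z u) z)"
      proof (rule dominated_convergence(2)[OF gint, where h = "\<lambda>_. C / \<epsilon>"])
        fix u assume u: "u \<in> {a..b}"
        show "norm (g i u) \<le> C / \<epsilon>" for i
        proof -
          have "cmod (F (X i) u - F z u) \<le> C / \<epsilon> * cmod (X i - z)"
            using strip[OF _ u] Xpos[of i] near[of z] \<epsilon> z
            by (intro half_plane_map_lipschitz[OF hol[OF u]]) (auto intro: less_imp_le)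
          then show ?thesis using Xpos(3)[of i] by (simp add: g_def norm_divide pos_divide_le_eq)
        qed
        have "((\<lambda>z. F z u) has_field_derivative deriv (\<lambda>z. F z u) z) (at z)"
          using holomorphic_derivI[OF hol[OF u] open_half_plane] z by simp
        then have "((\<lambda>w. (F w u - F z u) / (w - z)) \<longlongrightarrow> deriv (\<lambda>z. F z u) z) (at z)"
          by (simp add: has_field_derivative_iff)
        then show "(\<lambda>i. g i u) \<longlonglongrightarrow> deriv (\<lambda>z. F z u) z"
          using lim Xpos(3) unfolding tendsto_at_iff_sequentially g_def by (auto simp: o_def)
      qed auto
      moreover have "integral {a..b} (g i) = (integral {a..b} (F (X i)) - integral {a..b} (F z)) / (X i - z)" for i
        unfolding g_def divide_inverse
        using int[OF Xpos(1)[of i]] int[OF z] by (simp add: integral_diff)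
      ultimately show "((\<lambda>w. (integral {a..b} (F w) - integral {a..b} (F z)) / (w - z)) \<circ> X)
          \<longlonglongrightarrow> integral {a..b} (\<lambda>u. deriv (\<lambda>z. F z u) z)"
        by (simp add: o_def)
    qed
  qed (use \<epsilon> in auto)
qed

text \<open>
  Cauchy's inequality turns the locally uniform closeness of \<open>h t\<close> and \<open>h t0\<close> into
  closeness of their derivatives.
\<close>

lemma continuous_on_deriv_of_family:
  fixes h :: "'t::metric_space \<Rightarrow> complex \<Rightarrow> complex"
  assumes S: "open S" and hol: "\<And>t. t \<in> T \<Longrightarrow> h t holomorphic_on S"
    and cont: "continuous_on (S \<times> T) (\<lambda>(z, t). h t z)"
  shows "continuous_on (S \<times> T) (\<lambda>(z, t). deriv (h t) z)"
  unfolding continuous_on_iff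
proof (clarify)
  fix z0 t0 and e :: real assume z0: "z0 \<in> S" and t0: "t0 \<in> T" and "e > 0"
  obtain R where "R > 0" "cball z0 R \<subseteq> S" using S z0 open_contains_cball by blast
  define r where "r = R / 2"
  have r: "r > 0" "R = 2 * r" using \<open>R > 0\<close> by (auto simp: r_def)
  have "continuous_on S (deriv (h t0))"
    using hol[OF t0] S by (intro holomorphic_on_imp_continuous_on holomorphic_deriv)
  then obtain d1 where d1: "d1 > 0" "\<And>z. z \<in> S \<Longrightarrow> dist z z0 < d1 \<Longrightarrow> dist (deriv (h t0) z) (deriv (h t0) z0) < e / 2"
    using z0 \<open>e > 0\<close> unfolding continuous_on_iff by (metis half_gt_zero)
  have "continuous_on (T \<times> cball z0 R) (\<lambda>(t, z). h t z)"
  proof -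
    have "continuous_on (T \<times> cball z0 R) ((\<lambda>(z,t). h t z) \<circ> prod.swap)"
    proof (rule continuous_on_compose)
      have "prod.swap ` (T \<times> cball z0 R) = cball z0 R \<times> T" by (auto simp: image_def)
      then show "continuous_on (prod.swap ` (T \<times> cball z0 R)) (\<lambda>(z,t). h t z)"
        using \<open>cball z0 R \<subseteq> S\<close> by (intro continuous_on_subset[OF cont]) auto
    qed (rule continuous_on_swap)
    then show ?thesis by (rule continuous_on_eq) auto
  qed
  moreover have "e * r / 4 > 0" using \<open>e > 0\<close> r by simp
  ultimately obtain X0 where X0: "t0 \<in> X0" "open X0"
    "\<And>t z. t \<in> X0 \<inter> T \<Longrightarrow> z \<in> cball z0 R \<Longrightarrow> dist (h t z) (h t0 z) \<le> e * r / 4"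
    using continuous_on_prod_compactE[OF _ compact_cball t0, of z0 R "\<lambda>(t, z). h t z" "e * r / 4"]
    by (smt (verit) old.prod.case)
  then obtain d2 where d2: "d2 > 0" "ball t0 d2 \<subseteq> X0" using open_contains_ball by blast
  have close: "dist (deriv (h t) z) (deriv (h t0) z) < e / 2"
    if t: "t \<in> T" "dist t t0 < d2" and z: "dist z z0 < r" for t z
  proof -
    have sub: "cball z r \<subseteq> cball z0 R"
      using z r by (auto simp: dist_commute) (metis (no_types, opaque_lifting) add_mono dist_triangle_le less_imp_le mult_2 dist_commute)
    then have sub': "cball z r \<subseteq> S" using \<open>cball z0 R \<subseteq> S\<close> by blast
    define k where "k w = h t w - h t0 w" for w
    have holk: "k holomorphic_on S" unfolding k_def using hol t t0 by (intro holomorphic_intros) auto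
    have "cmod ((deriv ^^ 1) k z) \<le> fact 1 * (e * r / 4) / r ^ 1"
    proof (rule Cauchy_inequality)
      show "k holomorphic_on ball z r" using holk sub' by (meson ball_subset_cball holomorphic_on_subset order_trans)
      show "continuous_on (cball z r) k" using holk sub' by (meson holomorphic_on_imp_continuous_on continuous_on_subset)
      show "cmod (k x) \<le> e * r / 4" if "cmod (z - x) = r" for x
      proof -
        have "t \<in> X0 \<inter> T" using t d2 by (auto simp: dist_commute)
        moreover have "x \<in> cball z0 R" using sub that by (auto simp: dist_norm)
        ultimately show ?thesis using X0(3)[of t x] by (simp add: k_def dist_norm)
      qed
    qed (use r in auto)
    moreover have "deriv k z = deriv (h t) z - deriv (h t0) z"
    proof -
      have "z \<in> S" using sub' r by auto
      then show ?thesis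
        unfolding k_def using hol[OF t(1)] hol[OF t0] S
        by (intro deriv_diff) (auto intro: holomorphic_on_imp_differentiable_at)
    qed
    ultimately show ?thesis using r \<open>e > 0\<close> by (simp add: dist_norm)
  qed
  show "\<exists>d>0. \<forall>x'\<in>S \<times> T. dist x' (z0, t0) < d \<longrightarrow>
     dist (case x' of (z, t) \<Rightarrow> deriv (h t) z) (deriv (h t0) z0) < e"
  proof (intro exI conjI ballI impI)
    show "min d1 (min d2 r) > 0" using d1 d2 r by simp
    fix x' assume "x' \<in> S \<times> T" and dist: "dist x' (z0, t0) < min d1 (min d2 r)"
    then obtain z t where x': "x' = (z,t)" "z \<in> S" "t \<in> T" by auto
    have "dist z z0 < min d1 (min d2 r)" "dist t t0 < min d1 (min d2 r)"
      using dist dist_fst_le[of x' "(z0,t0)"] dist_snd_le[of x' "(z0,t0)"] x' by auto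
    then show "dist (case x' of (z, t) \<Rightarrow> deriv (h t) z) (deriv (h t0) z0) < e"
      using close[of t z] d1(2)[of z] x' dist_triangle_half_r[of "deriv (h t0) z" "deriv (h t) z" e "deriv (h t0) z0"]
      by (simp add: dist_commute)
  qed
qed

section \<open>The flow of a strip-valued field\<close>

lemma Re_integral_bounds:
  assumes f: "f integrable_on {s..t}" and "s \<le> t"
    and "\<And>u. u \<in> {s..t} \<Longrightarrow> C \<le> Re (f u) \<and> Re (f u) \<le> D"
  shows "C * (t - s) \<le> Re (integral {s..t} f)" "Re (integral {s..t} f) \<le> D * (t - s)"
proof -
  have "((\<lambda>u. Re (f u)) has_integral Re (integral {s..t} f)) {s..t}"
    using f by (intro has_integral_Re integrable_integral)
  moreover have "((\<lambda>u. C) has_integral C * (t - s)) {s..t}" "((\<lambda>u. D) has_integral D * (t - s)) {s..t}"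
    using has_integral_const_real[of C s t] has_integral_const_real[of D s t] \<open>s \<le> t\<close>
    by (simp_all add: mult.commute)
  ultimately show "C * (t - s) \<le> Re (integral {s..t} f)" "Re (integral {s..t} f) \<le> D * (t - s)"
    using assms(3) by (blast intro: has_integral_le)+
qed

lemma has_integral_power_over_fact:
  fixes s t c L :: real
  assumes "s \<le> t"
  shows "((\<lambda>u. c * (L * (u - s)) ^ n / fact n * L) has_integral (c * (L * (t - s)) ^ Suc n / fact (Suc n))) {s..t}"
proof -
  have "((\<lambda>u. c * (L * (u - s)) ^ n / fact n * L) has_integral
      (c * (L * (t - s)) ^ Suc n / fact (Suc n) - c * (L * (s - s)) ^ Suc n / fact (Suc n))) {s..t}"
  proof (rule fundamental_theorem_of_calculus[OF assms])
    fix x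
    have *: "((\<lambda>u. c * (L * (u - s)) ^ Suc n / fact (Suc n)) has_field_derivative
        (c * (real (Suc n) * (L * (x - s)) ^ n * L) / fact (Suc n))) (at x within {s..t})"
      by (rule derivative_eq_intros refl | simp)+
    have "c * (real (Suc n) * (L * (x - s)) ^ n * L) / fact (Suc n) = c * (L * (x - s)) ^ n / fact n * L"
      by (simp add: divide_simps)
    with * show "((\<lambda>u. c * (L * (u - s)) ^ Suc n / fact (Suc n)) has_vector_derivative c * (L * (x - s)) ^ n / fact n * L) (at x within {s..t})"
      unfolding has_real_derivative_iff_has_vector_derivative[symmetric] by (simp only:)
  qed
  moreover have "c * (L * (t - s)) ^ Suc n / fact (Suc n) - c * (L * (s - s)) ^ Suc n / fact (Suc n)
      = c * (L * (t - s)) ^ Suc n / fact (Suc n)"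
    by simp
  ultimately show ?thesis by (simp only:)
qed

lemma sums_exp_real: "(\<lambda>n. M * (x ^ n / fact n)) sums (M * exp x)" for M x :: real
proof (rule sums_mult)
  show "(\<lambda>n. x ^ n / fact n) sums exp x"
    using exp_converges[of x] by (simp only: real_scaleR_def divide_inverse mult.commute)
qed

locale strip_field =
  fixes q :: "complex \<Rightarrow> real \<Rightarrow> complex" and C1 C2 :: real
  assumes C1_pos: "0 < C1"
    and field_holomorphic: "(\<lambda>z. q z t) holomorphic_on right_half_plane"
    and field_strip: "0 < Re z \<Longrightarrow> C1 < Re (q z t) \<and> Re (q z t) < C2"
    and field_integrable: "0 < Re z \<Longrightarrow> q z absolutely_integrable_on {a..b}"
begin

lemma C2_pos: "0 < C2"
  using field_strip[of 1 0] C1_pos by simp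

lemma field_integrable_on:
  assumes "0 < Re z"
  shows "q z integrable_on {a..b}" "(\<lambda>u. cmod (q z u)) integrable_on {a..b}"
  using field_integrable[OF assms] unfolding absolutely_integrable_on_def by blast+

lemma field_lipschitz:
  assumes "0 < \<epsilon>" "\<epsilon> \<le> Re z" "\<epsilon> \<le> Re w"
  shows "cmod (q z t - q w t) \<le> C2 / \<epsilon> * cmod (z - w)"
proof (rule half_plane_map_lipschitz[OF field_holomorphic _ assms])
  show "0 < Re (q z t)" if "0 < Re z" for z using field_strip[OF that, of t] C1_pos by linarith
  show "Re (q z t) \<le> C2" "Re (q w t) \<le> C2" using assms field_strip[of z t] field_strip[of w t] by auto
qed

text \<open>
  The field is only measurable in time, so measurability along a curve is proved by
  freezing the curve on a fine grid: each frozen field is one of countably many measurable functions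
  at every time, and continuity in space gives the limit.
\<close>

lemma integrable_along:
  assumes y: "continuous_on {a..b} y" and "0 < \<epsilon>" and \<epsilon>: "\<And>u. u \<in> {a..b} \<Longrightarrow> \<epsilon> \<le> Re (y u)"
  shows "(\<lambda>u. q (y u) u) absolutely_integrable_on {a..b}"
proof (cases "a \<le> b")
  case True
  have pos: "0 < Re (y u)" if "u \<in> {a..b}" for u using \<epsilon>[OF that] \<open>0 < \<epsilon>\<close> by simp
  \<comment> \<open>The grid point of mesh \<open>1 / (n + 1)\<close> just below \<open>u\<close>.\<close>
  define \<sigma> where "\<sigma> n u = a + real_of_int \<lfloor>(u - a) * real (Suc n)\<rfloor> / real (Suc n)" for n u
  have \<sigma>: "\<sigma> n u \<in> {a..b}" "\<bar>\<sigma> n u - u\<bar> \<le> inverse (real (Suc n))" if "u \<in> {a..b}" for n u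
  proof -
    define x where "x = (u - a) * real (Suc n)"
    have x: "x \<ge> 0" "x / real (Suc n) = u - a" using that by (auto simp: x_def)
    have fl: "0 \<le> real_of_int \<lfloor>x\<rfloor>" "real_of_int \<lfloor>x\<rfloor> \<le> x" "x - 1 \<le> real_of_int \<lfloor>x\<rfloor>"
      using x(1) by (simp, simp, linarith)
    have d: "\<sigma> n u = a + real_of_int \<lfloor>x\<rfloor> / real (Suc n)" by (simp add: \<sigma>_def x_def)
    have "real_of_int \<lfloor>x\<rfloor> / real (Suc n) \<le> u - a" unfolding x(2)[symmetric] by (intro divide_right_mono fl) auto
    moreover have "(x - 1) / real (Suc n) \<le> real_of_int \<lfloor>x\<rfloor> / real (Suc n)" by (intro divide_right_mono fl) auto
    then have "u - a - inverse (real (Suc n)) \<le> real_of_int \<lfloor>x\<rfloor> / real (Suc n)"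
      using x(2) by (simp add: diff_divide_distrib inverse_eq_divide)
    moreover have "0 \<le> real_of_int \<lfloor>x\<rfloor> / real (Suc n)" using fl by simp
    ultimately show "\<sigma> n u \<in> {a..b}" "\<bar>\<sigma> n u - u\<bar> \<le> inverse (real (Suc n))"
      using that unfolding d by (auto simp: abs_le_iff)
  qed
  have meas: "(\<lambda>u. q (y (\<sigma> n u)) u) \<in> borel_measurable (lebesgue_on {a..b})" for n
  proof -
    define f where "f i u = (let v = a + real_of_int i / real (Suc n) in if v \<in> {a..b} then q (y v) u else 0)" for i u
    have "f i \<in> borel_measurable (lebesgue_on {a..b})" for i
      using absolutely_integrable_imp_borel_measurable[OF field_integrable[OF pos, of "a + real_of_int i / real (Suc n)" a b]]
      by (cases "a + real_of_int i / real (Suc n) \<in> {a..b}") (auto simp: f_def[abs_def] Let_def)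
    moreover have "(\<lambda>u. (u - a) * real (Suc n)) \<in> borel_measurable (lebesgue_on {a..b})"
      by (intro continuous_imp_measurable_on_sets_lebesgue continuous_intros) auto
    then have "(\<lambda>u. \<lfloor>(u - a) * real (Suc n)\<rfloor>) \<in> measurable (lebesgue_on {a..b}) (count_space UNIV)"
      by (rule measurable_compose[OF _ measurable_real_floor])
    ultimately have "(\<lambda>u. f \<lfloor>(u - a) * real (Suc n)\<rfloor> u) \<in> borel_measurable (lebesgue_on {a..b})"
      by (intro measurable_compose_countable[where f = f and g = "\<lambda>u. \<lfloor>(u - a) * real (Suc n)\<rfloor>"])
    then show ?thesis
      by (rule measurable_cong[THEN iffD1, rotated])
         (use \<sigma>(1)[of _ n] in \<open>auto simp: f_def \<sigma>_def Let_def space_restrict_space\<close>)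
  qed
  have conv: "(\<lambda>n. q (y (\<sigma> n u)) u) \<longlonglongrightarrow> q (y u) u" if u: "u \<in> {a..b}" for u
  proof -
    have "(\<lambda>n. \<sigma> n u) \<longlonglongrightarrow> u"
      by (rule LIM_zero_cancel, rule Lim_null_comparison[OF _ LIMSEQ_inverse_real_of_nat])
         (use \<sigma>(2)[OF u] in auto)
    then have "(\<lambda>n. y (\<sigma> n u)) \<longlonglongrightarrow> y u"
      by (rule continuous_on_tendsto_compose[OF y _ u]) (use \<sigma>(1)[OF u] in auto)
    moreover have "isCont (\<lambda>z. q z u) (y u)"
      using field_holomorphic[of u] pos[OF u] open_half_plane[of 0]
      by (metis continuous_on_eq_continuous_at holomorphic_on_imp_continuous_on mem_half_plane)
    ultimately show ?thesis by (rule isCont_tendsto_compose[rotated])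
  qed
  have "bounded (y ` {a..b})" using y by (intro compact_imp_bounded compact_continuous_image) auto
  then obtain B where B: "\<And>u. u \<in> {a..b} \<Longrightarrow> cmod (y u) \<le> B" unfolding bounded_iff by blast
  have qa: "q (y a) absolutely_integrable_on {a..b}" using field_integrable pos True by auto
  show ?thesis
  proof (rule measurable_bounded_by_integrable_imp_absolutely_integrable)
    show "(\<lambda>u. q (y u) u) \<in> borel_measurable (lebesgue_on {a..b})"
      by (rule borel_measurable_LIMSEQ_metric[where f = "\<lambda>n u. q (y (\<sigma> n u)) u", OF meas]) (use conv in \<open>auto simp: space_restrict_space\<close>)
    show "(\<lambda>u. cmod (q (y a) u) + C2 / \<epsilon> * (2 * B)) integrable_on {a..b}"
      using qa by (intro integrable_add) (auto simp: absolutely_integrable_on_def)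
    show "cmod (q (y u) u) \<le> cmod (q (y a) u) + C2 / \<epsilon> * (2 * B)" if "u \<in> {a..b}" for u
    proof -
      have "cmod (q (y u) u) \<le> cmod (q (y a) u) + cmod (q (y u) u - q (y a) u)"
        using norm_triangle_sub by blast
      also have "cmod (q (y u) u - q (y a) u) \<le> C2 / \<epsilon> * cmod (y u - y a)"
        using \<epsilon> that True by (intro field_lipschitz \<open>0 < \<epsilon>\<close>) auto
      also have "\<dots> \<le> C2 / \<epsilon> * (2 * B)"
        using B[OF that] B[of a] True norm_triangle_ineq4[of "y u" "y a"] C2_pos \<open>0 < \<epsilon>\<close>
        by (intro mult_left_mono) auto
      finally show ?thesis by simp
    qed
  qed auto
next
  case False
  then have "{a..b} = {}" by simp
  show ?thesis unfolding \<open>{a..b} = {}\<close> by (rule absolutely_integrable_negligible) simp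
qed

primrec picard :: "nat \<Rightarrow> real \<Rightarrow> complex \<Rightarrow> real \<Rightarrow> complex" where
  "picard 0 s z = (\<lambda>t. z)"
| "picard (Suc n) s z = (\<lambda>t. z + integral {s..t} (\<lambda>u. q (picard n s z u) u))"

lemma picard_continuous_and_Re:
  assumes z: "0 < Re z"
  shows "continuous_on {s..T} (picard n s z) \<and> (\<forall>t. Re z \<le> Re (picard n s z t))"
proof (induction n arbitrary: T)
  case (Suc n)
  have int: "(\<lambda>u. q (picard n s z u) u) absolutely_integrable_on {s..t}" for t
    using Suc by (intro integrable_along[where \<epsilon> = "Re z"] z) auto
  then have int': "(\<lambda>u. q (picard n s z u) u) integrable_on {s..t}" for t
    using absolutely_integrable_on_def by blast
  have "0 \<le> Re (integral {s..t} (\<lambda>u. q (picard n s z u) u))" for t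
  proof (cases "s \<le> t")
    case True
    have "0 * (t - s) \<le> Re (integral {s..t} (\<lambda>u. q (picard n s z u) u))"
    proof (rule Re_integral_bounds(1)[OF int' True])
      fix u
      have "Re z \<le> Re (picard n s z u)" using Suc by blast
      with z have "0 < Re (picard n s z u)" by linarith
      from field_strip[OF this, of u] C1_pos show "0 \<le> Re (q (picard n s z u) u) \<and> Re (q (picard n s z u) u) \<le> C2" by linarith
    qed
    then show ?thesis by simp
  qed simp
  moreover have "continuous_on {s..T} (\<lambda>t. z + integral {s..t} (\<lambda>u. q (picard n s z u) u))"
    by (intro continuous_intros indefinite_integral_continuous_1 int')
  ultimately show ?case by simp
qed auto

lemmas picard_continuous = picard_continuous_and_Re[THEN conjunct1]
lemmas picard_Re = picard_continuous_and_Re[THEN conjunct2, rule_format]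

lemma picard_integrable:
  assumes z: "0 < Re z"
  shows "(\<lambda>u. q (picard n s z u) u) absolutely_integrable_on {s..t}"
proof (rule integrable_along[where y = "picard n s z" and \<epsilon> = "Re z"])
  show "continuous_on {s..t} (picard n s z)" by (rule picard_continuous[OF z])
  show "Re z \<le> Re (picard n s z u)" for u by (rule picard_Re[OF z])
qed (rule z)

text \<open>
  No estimate of the dependence on \<open>z\<close> has to be carried through the induction: for each
  time \<open>u\<close> the integrand \<open>\<lambda>z. q (picard n s z u) u\<close> is itself a holomorphic map into the
  strip, so \<open>holomorphic_integral_of_strip_maps\<close> applies.
\<close>

lemma picard_holomorphic: "(\<lambda>z. picard n s z t) holomorphic_on right_half_plane"
proof (induction n arbitrary: t)
  case 0
  then show ?case by (simp add: holomorphic_on_ident)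
next
  case (Suc n)
  have pos: "0 < Re (picard n s z u)" if "0 < Re z" for z u using picard_Re[OF that, of n s u] that by linarith
  have "(\<lambda>z. integral {s..t} (\<lambda>u. q (picard n s z u) u)) holomorphic_on right_half_plane"
  proof (rule holomorphic_integral_of_strip_maps)
    fix u
    have "(\<lambda>z. q z u) \<circ> (\<lambda>z. picard n s z u) holomorphic_on right_half_plane"
      by (rule holomorphic_on_compose_gen[OF Suc field_holomorphic]) (use pos in auto)
    then show "(\<lambda>z. q (picard n s z u) u) holomorphic_on right_half_plane" by (simp add: o_def)
  next
    fix z u assume "0 < Re z"
    from field_strip[OF pos[OF this], of u u] C1_pos
    show "0 < Re (q (picard n s z u) u) \<and> Re (q (picard n s z u) u) < C2" by linarith
  next
    fix z assume "0 < Re z"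
    then show "(\<lambda>u. q (picard n s z u) u) integrable_on {s..t}"
      using picard_integrable absolutely_integrable_on_def by blast
  qed
  then show ?case by (auto intro: holomorphic_intros)
qed

lemma picard_step:
  assumes "0 < \<epsilon>" "\<epsilon> \<le> Re z" "s \<le> t" "t \<le> T"
  shows "cmod (picard (Suc n) s z t - picard n s z t)
    \<le> integral {s..T} (\<lambda>u. cmod (q z u)) * (C2 / \<epsilon> * (t - s)) ^ n / fact n"
  using assms(3,4)
proof (induction n arbitrary: t)
  case 0
  have z: "0 < Re z" using assms by simp
  have "cmod (integral {s..t} (q z)) \<le> integral {s..t} (\<lambda>u. cmod (q z u))"
    by (rule integral_norm_bound_integral[OF field_integrable_on[OF z] order_refl])
  also have "\<dots> \<le> integral {s..T} (\<lambda>u. cmod (q z u))"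
    by (rule integral_subset_le[OF _ field_integrable_on(2)[OF z] field_integrable_on(2)[OF z]]) (use 0 in auto)
  finally show ?case by simp
next
  case (Suc n)
  have z: "0 < Re z" using assms by simp
  have int: "(\<lambda>u. q (picard n s z u) u) integrable_on {s..t}" for n
    using picard_integrable[OF z] absolutely_integrable_on_def by blast
  define M where "M = integral {s..T} (\<lambda>u. cmod (q z u))"
  let ?L = "C2 / \<epsilon>"
  have hi: "((\<lambda>u. M * (?L * (u - s)) ^ n / fact n * ?L) has_integral (M * (?L * (t - s)) ^ Suc n / fact (Suc n))) {s..t}"
    by (rule has_integral_power_over_fact[OF Suc.prems(1)])
  have "picard (Suc (Suc n)) s z t - picard (Suc n) s z t =
      integral {s..t} (\<lambda>u. q (picard (Suc n) s z u) u - q (picard n s z u) u)"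
    using integral_diff[OF int[of "Suc n"] int[of n]] by simp
  also have "cmod \<dots> \<le> integral {s..t} (\<lambda>u. M * (?L * (u - s)) ^ n / fact n * ?L)"
  proof (rule integral_norm_bound_integral)
    show "(\<lambda>u. q (picard (Suc n) s z u) u - q (picard n s z u) u) integrable_on {s..t}"
      by (rule integrable_diff[OF int int])
    show "(\<lambda>u. M * (?L * (u - s)) ^ n / fact n * ?L) integrable_on {s..t}"
      using hi by (rule has_integral_integrable)
    fix u assume u: "u \<in> {s..t}"
    have "cmod (q (picard (Suc n) s z u) u - q (picard n s z u) u) \<le> ?L * cmod (picard (Suc n) s z u - picard n s z u)"
      using picard_Re[OF z, of _ s u] assms by (intro field_lipschitz) (meson order_trans)+
    also have "\<dots> \<le> ?L * (M * (?L * (u - s)) ^ n / fact n)"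
      using Suc.IH[of u] Suc.prems u C2_pos assms(1) unfolding M_def by (intro mult_left_mono) auto
    finally show "cmod (q (picard (Suc n) s z u) u - q (picard n s z u) u) \<le> M * (?L * (u - s)) ^ n / fact n * ?L"
      by (simp only: mult.commute)
  qed
  also have "\<dots> = M * (?L * (t - s)) ^ Suc n / fact (Suc n)" using hi by (rule integral_unique)
  finally show ?case unfolding M_def .
qed

text \<open>
  The limit of the Picard iterates, written as the telescoping series whose terms
  \<open>picard_step\<close> estimates.
\<close>

definition flow :: "real \<Rightarrow> real \<Rightarrow> complex \<Rightarrow> complex" where
  "flow s t z = z + (\<Sum>n. picard (Suc n) s z t - picard n s z t)"

text \<open>
  The sum of the bounds for the Picard steps. It serves as the a priori estimate for
  trajectories, in place of Gronwall's inequality.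
\<close>

lemma flow_displacement:
  assumes "0 < \<epsilon>" "\<epsilon> \<le> Re z" "s \<le> t"
  shows "cmod (flow s t z - z) \<le> exp (C2 / \<epsilon> * (t - s)) * integral {s..t} (\<lambda>u. cmod (q z u))"
proof -
  let ?M = "integral {s..t} (\<lambda>u. cmod (q z u))" and ?x = "C2 / \<epsilon> * (t - s)"
  note sums = sums_exp_real[of ?M ?x]
  have "cmod (picard (Suc n) s z t - picard n s z t) \<le> ?M * (?x ^ n / fact n)" for n
    using picard_step[OF assms order_refl, of n] by (simp only: times_divide_eq_right)
  then have "cmod (\<Sum>n. picard (Suc n) s z t - picard n s z t) \<le> (\<Sum>n. ?M * (?x ^ n / fact n))"
    by (rule norm_suminf_le[OF _ sums_summable[OF sums]])
  also have "\<dots> = ?M * exp ?x" by (rule sums_unique[OF sums, symmetric])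
  finally show ?thesis by (simp add: flow_def mult.commute)
qed

text \<open>
  Uniformity in the initial point and in time together: the first is needed for
  holomorphy of the flow, the second for continuity of trajectories and for the integral equation.
\<close>

lemma picard_uniform_limit:
  assumes z0: "0 < Re z0"
  shows "uniform_limit (cball z0 (Re z0 / 2) \<times> {s..T}) (\<lambda>n (z, t). picard n s z t) (\<lambda>(z, t). flow s t z) sequentially"
proof -
  define \<epsilon> where "\<epsilon> = Re z0 / 2"
  have \<epsilon>: "0 < \<epsilon>" using z0 by (simp add: \<epsilon>_def)
  have near: "\<epsilon> \<le> Re z" if "z \<in> cball z0 \<epsilon>" for z
  proof -
    have "Re (z0 - z) \<le> \<epsilon>" using that complex_Re_le_cmod[of "z0 - z"] by (simp add: dist_norm)
    then show ?thesis by (simp add: \<epsilon>_def)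
  qed
  define M where "M = integral {s..T} (\<lambda>u. cmod (q z0 u) + C2)"
  let ?x = "C2 / \<epsilon> * (T - s)"
  have lim: "uniform_limit (cball z0 \<epsilon> \<times> {s..T})
      (\<lambda>n p. \<Sum>i<n. picard (Suc i) s (fst p) (snd p) - picard i s (fst p) (snd p))
      (\<lambda>p. \<Sum>i. picard (Suc i) s (fst p) (snd p) - picard i s (fst p) (snd p)) sequentially"
  proof (rule Weierstrass_m_test)
    show "summable (\<lambda>n. M * (?x ^ n / fact n))"
      by (rule sums_summable[OF sums_exp_real])
    fix n p assume "p \<in> cball z0 \<epsilon> \<times> {s..T}"
    then obtain z t where p: "p = (z,t)" "z \<in> cball z0 \<epsilon>" "s \<le> t" "t \<le> T" by auto
    have int: "(\<lambda>u. cmod (q z u)) integrable_on {s..T}" if "0 < Re z" for z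
      by (rule field_integrable_on(2)[OF that])
    have "integral {s..T} (\<lambda>u. cmod (q z u)) \<le> M"
      unfolding M_def
    proof (rule integral_le)
      show "(\<lambda>u. cmod (q z u)) integrable_on {s..T}" using near[OF p(2)] \<epsilon> by (intro int) simp
      show "(\<lambda>u. cmod (q z0 u) + C2) integrable_on {s..T}" by (intro integrable_add int z0) auto
      fix u
      have "cmod (q z u) \<le> cmod (q z0 u) + cmod (q z u - q z0 u)" using norm_triangle_sub by blast
      also have "cmod (q z u - q z0 u) \<le> C2 / \<epsilon> * cmod (z - z0)"
        using near[OF p(2)] \<epsilon> by (intro field_lipschitz) (auto simp: \<epsilon>_def)
      also have "\<dots> \<le> C2 / \<epsilon> * \<epsilon>" using p(2) C2_pos \<epsilon> by (intro mult_left_mono) (auto simp: dist_norm norm_minus_commute)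
      finally show "cmod (q z u) \<le> cmod (q z0 u) + C2" using \<epsilon> by simp
    qed
    moreover have "0 \<le> integral {s..T} (\<lambda>u. cmod (q z u))" using near[OF p(2)] \<epsilon> by (intro integral_nonneg int) auto
    moreover have "0 \<le> C2 / \<epsilon> * (t - s)" "C2 / \<epsilon> * (t - s) \<le> ?x"
      using p C2_pos \<epsilon> by (auto intro!: mult_left_mono divide_right_mono)
    ultimately have "integral {s..T} (\<lambda>u. cmod (q z u)) * (C2 / \<epsilon> * (t - s)) ^ n \<le> M * ?x ^ n"
      using power_mono[of "C2 / \<epsilon> * (t - s)" ?x n] by (intro mult_mono) (auto intro: order_trans)
    then have "integral {s..T} (\<lambda>u. cmod (q z u)) * (C2 / \<epsilon> * (t - s)) ^ n / fact n \<le> M * ?x ^ n / fact n"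
      by (rule divide_right_mono) simp
    then show "cmod (picard (Suc n) s (fst p) (snd p) - picard n s (fst p) (snd p)) \<le> M * (?x ^ n / fact n)"
      using picard_step[OF \<epsilon> near[OF p(2)] p(3,4), of n] by (simp add: p(1))
  qed
  have "uniform_limit (cball z0 \<epsilon> \<times> {s..T})
      (\<lambda>n p. fst p + (\<Sum>i<n. picard (Suc i) s (fst p) (snd p) - picard i s (fst p) (snd p)))
      (\<lambda>p. fst p + (\<Sum>i. picard (Suc i) s (fst p) (snd p) - picard i s (fst p) (snd p))) sequentially"
    by (intro uniform_limit_add uniform_limit_const lim)
  moreover have "z + (\<Sum>i<n. picard (Suc i) s z t - picard i s z t) = picard n s z t" for n z t
    by (subst sum_lessThan_telescope) simp
  ultimately show ?thesis
    by (simp add: \<epsilon>_def[symmetric] case_prod_unfold flow_def del: picard.simps)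
qed


lemma picard_uniform_limit_time:
  assumes z: "0 < Re z"
  shows "uniform_limit {s..T} (\<lambda>n t. picard n s z t) (\<lambda>t. flow s t z) sequentially"
  unfolding uniform_limit_iff
proof (intro allI impI)
  fix e :: real assume "e > 0"
  then have "\<forall>\<^sub>F n in sequentially. \<forall>x\<in>cball z (Re z / 2) \<times> {s..T}.
      dist (case x of (z, t) \<Rightarrow> picard n s z t) (case x of (z, t) \<Rightarrow> flow s t z) < e"
    using picard_uniform_limit[OF z, of s T] unfolding uniform_limit_iff by blast
  then show "\<forall>\<^sub>F n in sequentially. \<forall>t\<in>{s..T}. dist (picard n s z t) (flow s t z) < e"
  proof eventually_elim
    case (elim n)
    show ?case
    proof
      fix t assume "t \<in> {s..T}"
      then show "dist (picard n s z t) (flow s t z) < e" using bspec[OF elim, of "(z,t)"] z by simp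
    qed
  qed
qed

lemma flow_continuous:
  assumes z: "0 < Re z"
  shows "continuous_on {s..T} (\<lambda>t. flow s t z)"
  by (rule uniform_limit_theorem[OF _ picard_uniform_limit_time[OF z] trivial_limit_sequentially])
     (simp add: picard_continuous[OF z])

lemma picard_tendsto_flow:
  assumes z: "0 < Re z" and "s \<le> t"
  shows "(\<lambda>n. picard n s z t) \<longlonglongrightarrow> flow s t z"
  by (rule tendsto_uniform_limitI[OF picard_uniform_limit_time[OF z, of s t]]) (use \<open>s \<le> t\<close> in auto)

lemma flow_Re_ge:
  assumes z: "0 < Re z" and "s \<le> t"
  shows "Re z \<le> Re (flow s t z)"
  by (rule LIMSEQ_le_const[OF tendsto_Re[OF picard_tendsto_flow[OF assms]]])
     (use picard_Re[OF z] in blast)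

lemma flow_holomorphic:
  assumes "s \<le> t"
  shows "flow s t holomorphic_on right_half_plane"
proof (rule holomorphic_uniform_sequence[OF open_half_plane picard_holomorphic[of _ s t]])
  fix z assume "z \<in> right_half_plane"
  then have z: "0 < Re z" by simp
  show "\<exists>d>0. cball z d \<subseteq> right_half_plane \<and> uniform_limit (cball z d) (\<lambda>n z. picard n s z t) (flow s t) sequentially"
  proof (intro exI conjI)
    show "0 < Re z / 2" using z by simp
    show "cball z (Re z / 2) \<subseteq> right_half_plane"
    proof
      fix w assume "w \<in> cball z (Re z / 2)"
      then have "Re (z - w) \<le> Re z / 2" using complex_Re_le_cmod[of "z - w"] by (simp add: dist_norm)
      then show "w \<in> right_half_plane" using z by simp
    qed
    show "uniform_limit (cball z (Re z / 2)) (\<lambda>n z. picard n s z t) (flow s t) sequentially"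
      unfolding uniform_limit_iff
    proof (intro allI impI)
      fix e :: real assume "e > 0"
      then have "\<forall>\<^sub>F n in sequentially. \<forall>x\<in>cball z (Re z / 2) \<times> {s..t}.
          dist (case x of (z, t) \<Rightarrow> picard n s z t) (case x of (z, t) \<Rightarrow> flow s t z) < e"
        using picard_uniform_limit[OF z, of s t] unfolding uniform_limit_iff by blast
      then show "\<forall>\<^sub>F n in sequentially. \<forall>w\<in>cball z (Re z / 2). dist (picard n s w t) (flow s t w) < e"
      proof eventually_elim
        case (elim n)
        show ?case
        proof
          fix w assume "w \<in> cball z (Re z / 2)"
          then show "dist (picard n s w t) (flow s t w) < e"
            using bspec[OF elim, of "(w,t)"] \<open>s \<le> t\<close> by simp
        qed
      qed
    qed
  qed
qed

lemma flow_integrable: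
  assumes z: "0 < Re z" and "s \<le> a"
  shows "(\<lambda>u. q (flow s u z) u) absolutely_integrable_on {a..b}"
proof (rule integrable_along[where y = "\<lambda>u. flow s u z" and \<epsilon> = "Re z"])
  show "continuous_on {a..b} (\<lambda>u. flow s u z)"
    by (rule continuous_on_subset[OF flow_continuous[OF z, of s b]]) (use \<open>s \<le> a\<close> in auto)
  show "Re z \<le> Re (flow s u z)" if "u \<in> {a..b}" for u using flow_Re_ge[OF z] that \<open>s \<le> a\<close> by simp
qed (rule z)

lemma flow_integrable_on:
  assumes "0 < Re z" and "s \<le> a"
  shows "(\<lambda>u. q (flow s u z) u) integrable_on {a..b}" "(\<lambda>u. cmod (q (flow s u z) u)) integrable_on {a..b}"
  using flow_integrable[OF assms] unfolding absolutely_integrable_on_def by blast+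

lemma flow_integral_equation:
  assumes z: "0 < Re z" and "s \<le> t"
  shows "flow s t z = z + integral {s..t} (\<lambda>u. q (flow s u z) u)"
proof -
  have pint: "(\<lambda>u. q (picard n s z u) u) integrable_on {s..t}" for n
    using picard_integrable[OF z, where n = n and s = s and t = t] unfolding absolutely_integrable_on_def by blast
  let ?L = "C2 / Re z"
  have L: "?L > 0" using C2_pos z by simp
  have "(\<lambda>n. integral {s..t} (\<lambda>u. q (picard n s z u) u)) \<longlonglongrightarrow> integral {s..t} (\<lambda>u. q (flow s u z) u)"
    unfolding tendsto_iff
  proof (intro allI impI)
    fix e :: real assume "e > 0"
    define d where "d = e / (?L * (t - s) + 1)"
    have den: "?L * (t - s) + 1 > 0"
      using L \<open>s \<le> t\<close> by (intro add_nonneg_pos mult_nonneg_nonneg) auto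
    have d: "d > 0" using \<open>e > 0\<close> den by (simp add: d_def)
    have "\<forall>\<^sub>F n in sequentially. \<forall>u\<in>{s..t}. dist (picard n s z u) (flow s u z) < d"
      using picard_uniform_limit_time[OF z, of s t] d unfolding uniform_limit_iff by blast
    then show "\<forall>\<^sub>F n in sequentially. dist (integral {s..t} (\<lambda>u. q (picard n s z u) u)) (integral {s..t} (\<lambda>u. q (flow s u z) u)) < e"
    proof eventually_elim
      case (elim n)
      have "cmod (integral {s..t} (\<lambda>u. q (picard n s z u) u - q (flow s u z) u)) \<le> integral {s..t} (\<lambda>u. ?L * d)"
      proof (rule integral_norm_bound_integral)
        show "(\<lambda>u. q (picard n s z u) u - q (flow s u z) u) integrable_on {s..t}"
          by (rule integrable_diff[OF pint flow_integrable_on(1)[OF z order_refl]])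
        show "(\<lambda>u. ?L * d) integrable_on {s..t}" by (rule integrable_const_ivl)
        fix u assume u: "u \<in> {s..t}"
        have "cmod (q (picard n s z u) u - q (flow s u z) u) \<le> ?L * cmod (picard n s z u - flow s u z)"
          using picard_Re[OF z] flow_Re_ge[OF z, of s u] u by (intro field_lipschitz z) auto
        also have "\<dots> \<le> ?L * d" using elim u L by (intro mult_left_mono) (auto simp: dist_norm intro: less_imp_le)
        finally show "cmod (q (picard n s z u) u - q (flow s u z) u) \<le> ?L * d" .
      qed
      also have "\<dots> = ?L * (t - s) * d" using \<open>s \<le> t\<close> by simp
      also have "\<dots> < (?L * (t - s) + 1) * d" using d by (simp add: distrib_right)
      also have "\<dots> = e" using den by (simp add: d_def)
      finally show ?case
        using integral_diff[OF pint[of n] flow_integrable_on(1)[OF z order_refl]] by (simp add: dist_norm)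
    qed
  qed
  then have "(\<lambda>n. picard (Suc n) s z t) \<longlonglongrightarrow> z + integral {s..t} (\<lambda>u. q (flow s u z) u)"
    by (auto intro: tendsto_intros)
  moreover have "(\<lambda>n. picard (Suc n) s z t) \<longlonglongrightarrow> flow s t z"
    by (rule LIMSEQ_Suc[OF picard_tendsto_flow[OF assms]])
  ultimately show ?thesis using LIMSEQ_unique by blast
qed

lemma flow_increment:
  assumes z: "0 < Re z" and "s \<le> u" "u \<le> t"
  shows "flow s t z - flow s u z = integral {u..t} (\<lambda>v. q (flow s v z) v)"
proof -
  have "integral {s..u} (\<lambda>v. q (flow s v z) v) + integral {u..t} (\<lambda>v. q (flow s v z) v)
      = integral {s..t} (\<lambda>v. q (flow s v z) v)"
    by (rule Henstock_Kurzweil_Integration.integral_combine[OF assms(2,3) flow_integrable_on(1)[OF z order_refl]])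
  then show ?thesis
    unfolding flow_integral_equation[OF z order_trans[OF assms(2,3)]] flow_integral_equation[OF z assms(2)]
    by (simp add: algebra_simps)
qed

lemma flow_initial [simp]: "0 < Re z \<Longrightarrow> flow s s z = z"
  using flow_integral_equation[of z s s] by simp

lemma flow_Re_bounds:
  assumes z: "0 < Re z" and "s \<le> t"
  shows "Re z + C1 * (t - s) \<le> Re (flow s t z)" "Re (flow s t z) \<le> Re z + C2 * (t - s)"
proof -
  have "C1 \<le> Re (q (flow s u z) u) \<and> Re (q (flow s u z) u) \<le> C2" if "u \<in> {s..t}" for u
  proof -
    have "0 < Re (flow s u z)" using flow_Re_ge[OF z, of s u] that z by simp
    from field_strip[OF this, of u] show ?thesis by simp
  qed
  note b = Re_integral_bounds[OF flow_integrable_on(1)[OF z order_refl] \<open>s \<le> t\<close> this]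
  show "Re z + C1 * (t - s) \<le> Re (flow s t z)" "Re (flow s t z) \<le> Re z + C2 * (t - s)"
    using b flow_integral_equation[OF assms] by simp_all
qed

lemma flow_Re_pos: "0 < Re z \<Longrightarrow> s \<le> t \<Longrightarrow> 0 < Re (flow s t z)"
  using flow_Re_ge[of z s t] by linarith

text \<open>
  Uniqueness in both directions of time, as \<open>c\<close> may be any point of the interval: the
  forward direction gives the semigroup property of the flow, the backward one its injectivity.
  The set where the two solutions agree is closed, and it is open because within time
  \<open>1 / (2 * L)\<close> of a common point the maximal distance is at most half of itself.
\<close>

lemma solutions_agree:
  assumes cont: "continuous_on {a..b} y1" "continuous_on {a..b} y2"
    and \<epsilon>: "0 < \<epsilon>" "\<And>u. u \<in> {a..b} \<Longrightarrow> \<epsilon> \<le> Re (y1 u)" "\<And>u. u \<in> {a..b} \<Longrightarrow> \<epsilon> \<le> Re (y2 u)"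
    and y1: "\<And>u v. a \<le> u \<Longrightarrow> u \<le> v \<Longrightarrow> v \<le> b \<Longrightarrow> y1 v - y1 u = integral {u..v} (\<lambda>w. q (y1 w) w)"
    and y2: "\<And>u v. a \<le> u \<Longrightarrow> u \<le> v \<Longrightarrow> v \<le> b \<Longrightarrow> y2 v - y2 u = integral {u..v} (\<lambda>w. q (y2 w) w)"
    and c: "c \<in> {a..b}" "y1 c = y2 c" and t: "t \<in> {a..b}"
  shows "y1 t = y2 t"
proof -
  define L where "L = C2 / \<epsilon>"
  have L: "L > 0" using C2_pos \<epsilon> by (simp add: L_def)
  define D where "D u = cmod (y1 u - y2 u)" for u
  have contD: "continuous_on {a..b} D" unfolding D_def using cont by (intro continuous_intros)
  have incr: "\<bar>D v - D u\<bar> \<le> L * m * (v - u)"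
    if uv: "a \<le> u" "u \<le> v" "v \<le> b" and m: "\<And>w. w \<in> {u..v} \<Longrightarrow> D w \<le> m" for u v m
  proof -
    have i: "(\<lambda>w. q (y1 w) w) integrable_on {u..v}" "(\<lambda>w. q (y2 w) w) integrable_on {u..v}"
      using integrable_along[OF continuous_on_subset[OF cont(1)] \<epsilon>(1), of u v]
        integrable_along[OF continuous_on_subset[OF cont(2)] \<epsilon>(1), of u v] \<epsilon> uv
      unfolding absolutely_integrable_on_def by auto
    have "\<bar>D v - D u\<bar> \<le> cmod ((y1 v - y2 v) - (y1 u - y2 u))"
      unfolding D_def by (rule norm_triangle_ineq3)
    also have "(y1 v - y2 v) - (y1 u - y2 u) = integral {u..v} (\<lambda>w. q (y1 w) w - q (y2 w) w)"
      using y1[OF uv] y2[OF uv] integral_diff[OF i] by (simp add: algebra_simps)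
    also have "cmod \<dots> \<le> integral {u..v} (\<lambda>w. L * m)"
    proof (rule integral_norm_bound_integral)
      fix w assume w: "w \<in> {u..v}"
      then have "w \<in> {a..b}" using uv by auto
      then have "cmod (q (y1 w) w - q (y2 w) w) \<le> L * D w"
        unfolding L_def D_def by (intro field_lipschitz \<epsilon>)
      also have "\<dots> \<le> L * m" using m[OF w] L by simp
      finally show "cmod (q (y1 w) w - q (y2 w) w) \<le> L * m" .
    qed (use i in \<open>auto intro: integrable_diff\<close>)
    also have "\<dots> = L * m * (v - u)" using uv by simp
    finally show ?thesis .
  qed
  let ?Z = "{u \<in> {a..b}. D u = 0}"
  have "openin (top_of_set {a..b}) ?Z"
    unfolding openin_euclidean_subtopology_iff
  proof (intro conjI ballI)
    fix t0 assume t0: "t0 \<in> ?Z"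
    define \<eta> where "\<eta> = 1 / (2 * L)"
    have \<eta>: "\<eta> > 0" "L * \<eta> = 1 / 2" using L by (auto simp: \<eta>_def)
    define a' b' where "a' = max a (t0 - \<eta>)" "b' = min b (t0 + \<eta>)"
    have ab': "a' \<le> t0" "t0 \<le> b'" "a \<le> a'" "b' \<le> b" "t0 - \<eta> \<le> a'" "b' \<le> t0 + \<eta>"
      using t0 \<eta> by (auto simp: a'_b'_def)
    obtain t1 where t1: "t1 \<in> {a'..b'}" "\<And>w. w \<in> {a'..b'} \<Longrightarrow> D w \<le> D t1"
      using continuous_attains_sup[of "{a'..b'}" D] continuous_on_subset[OF contD, of "{a'..b'}"] ab'
      by (metis atLeastAtMost_iff atLeastatMost_subset_iff compact_Icc empty_iff)
    have "D t1 \<le> L * D t1 * \<eta>"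
    proof (cases "t0 \<le> t1")
      case True
      have "D t1 \<le> L * D t1 * (t1 - t0)"
        using incr[of t0 t1 "D t1"] True t0 t1 ab' by auto
      also have "\<dots> \<le> L * D t1 * \<eta>" using L t1 ab' by (intro mult_left_mono) (auto simp: D_def)
      finally show ?thesis .
    next
      case False
      have "D t1 \<le> L * D t1 * (t0 - t1)"
        using incr[of t1 t0 "D t1"] False t0 t1 ab' by auto
      also have "\<dots> \<le> L * D t1 * \<eta>" using L t1 ab' by (intro mult_left_mono) (auto simp: D_def)
      finally show ?thesis .
    qed
    also have "\<dots> = D t1 * (L * \<eta>)" by (simp only: ac_simps)
    finally have "D t1 \<le> 0" unfolding \<eta>(2) by simp
    show "\<exists>e>0. \<forall>x'\<in>{a..b}. dist x' t0 < e \<longrightarrow> x' \<in> ?Z"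
    proof (intro exI[of _ \<eta>] conjI ballI impI \<eta>(1))
      fix x assume "x \<in> {a..b}" "dist x t0 < \<eta>"
      then have "x \<in> {a'..b'}" by (auto simp: a'_b'_def dist_real_def)
      then show "x \<in> ?Z" using t1(2)[of x] \<open>D t1 \<le> 0\<close> \<open>x \<in> {a..b}\<close> by (auto simp: D_def)
    qed
  qed auto
  moreover have "closedin (top_of_set {a..b}) ?Z"
    by (rule continuous_closedin_preimage_constant[OF contD])
  ultimately have "?Z = {} \<or> ?Z = {a..b}"
    using connected_clopen[of "{a..b}"] connected_Icc by blast
  moreover have "c \<in> ?Z" using c by (simp add: D_def)
  ultimately have "t \<in> ?Z" using t by blast
  then show ?thesis by (simp add: D_def)
qed

lemma flow_semigroup:
  assumes z: "0 < Re z" and "s \<le> u" "u \<le> t"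
  shows "flow u t (flow s u z) = flow s t z"
proof (rule solutions_agree[of u t "\<lambda>t. flow u t (flow s u z)" "\<lambda>t. flow s t z" "Re z" u t])
  have p: "0 < Re (flow s u z)" "Re z \<le> Re (flow s u z)" using flow_Re_pos flow_Re_ge assms by auto
  show "continuous_on {u..t} (\<lambda>t. flow u t (flow s u z))" by (rule flow_continuous[OF p(1)])
  show "continuous_on {u..t} (\<lambda>t. flow s t z)"
    by (rule continuous_on_subset[OF flow_continuous[OF z, of s t]]) (use assms in auto)
  show "Re z \<le> Re (flow u v (flow s u z))" if "v \<in> {u..t}" for v
    using flow_Re_ge[OF p(1), of u v] p that by simp
  show "Re z \<le> Re (flow s v z)" if "v \<in> {u..t}" for v
    using flow_Re_ge[OF z, of s v] assms that by simp
  show "flow u w (flow s u z) - flow u v (flow s u z) = integral {v..w} (\<lambda>v. q (flow u v (flow s u z)) v)"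
    if "u \<le> v" "v \<le> w" "w \<le> t" for v w using flow_increment[OF p(1)] that by blast
  show "flow s w z - flow s v z = integral {v..w} (\<lambda>v. q (flow s v z) v)"
    if "u \<le> v" "v \<le> w" "w \<le> t" for v w using flow_increment[OF z] that assms by simp
  show "flow u u (flow s u z) = flow s u z" using p by simp
qed (use assms in auto)

lemma flow_injective:
  assumes "0 < Re z" "0 < Re w" "s \<le> t" "flow s t z = flow s t w"
  shows "z = w"
proof -
  have "flow s s z = flow s s w"
  proof (rule solutions_agree[of s t "\<lambda>t. flow s t z" "\<lambda>t. flow s t w" "min (Re z) (Re w)" t s])
    show "min (Re z) (Re w) \<le> Re (flow s u z)" "min (Re z) (Re w) \<le> Re (flow s u w)" if "u \<in> {s..t}" for u
      using flow_Re_ge[of z s u] flow_Re_ge[of w s u] assms that by auto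
  qed (use assms flow_continuous flow_increment in auto)
  then show ?thesis using assms by simp
qed

end

section \<open>Regularity and hyperbolic contraction of the flow\<close>

context strip_field
begin

lemma flow_locally_abs_continuous:
  assumes z: "0 < Re z"
  shows "locally_abs_continuous_from s (\<lambda>t. flow s t z)"
  unfolding locally_abs_continuous_from_def
proof (intro allI impI)
  fix T assume "s \<le> T"
  show "abs_continuous_on_interval s T (\<lambda>t. flow s t z)"
  proof (rule abs_continuous_integral_bound[where k = "\<lambda>u. cmod (q (flow s u z) u)"])
    fix u v assume uv: "s \<le> u" "u \<le> v" "v \<le> T"
    show "norm (flow s v z - flow s u z) \<le> integral {u..v} (\<lambda>u. cmod (q (flow s u z) u))"
      unfolding flow_increment[OF z uv(1,2)]
      by (rule integral_norm_bound_integral[OF flow_integrable_on[OF z uv(1)] order_refl])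
  qed (use flow_integrable_on[OF z] in auto)
qed

text \<open>
  On each compact time interval this is Lebesgue's differentiation theorem for the integral
  equation; a countable union of null sets covers the half-line.
\<close>

lemma flow_derivative_AE:
  assumes z: "0 < Re z"
  shows "AE t in lebesgue. s \<le> t \<longrightarrow>
    ((\<lambda>t. flow s t z) has_vector_derivative q (flow s t z) t) (at t within {s..})"
proof -
  let ?v = "\<lambda>t. q (flow s t z) t"
  define N where "N n = {t \<in> {s..s + real n}. \<not> ((\<lambda>t. integral {s..t} ?v) has_vector_derivative ?v t)
      (at t within {s..s + real n})}" for n
  have "negligible (N n)" for n
    unfolding N_def
    by (rule negligible_not_indefinite_integral_derivative[OF flow_integrable_on(1)[OF z order_refl]])
  then have neg: "negligible (\<Union>n. N n)" by (rule negligible_Union_nat)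
  show ?thesis
  proof (rule AE_I'[where N = "\<Union>n. N n"])
    show "(\<Union>n. N n) \<in> null_sets lebesgue" using neg by (simp add: negligible_iff_null_sets)
    show "{t \<in> space lebesgue. \<not> (s \<le> t \<longrightarrow> ((\<lambda>t. flow s t z) has_vector_derivative ?v t) (at t within {s..}))} \<subseteq> (\<Union>n. N n)"
    proof (rule subsetI)
      fix t assume "t \<in> {t \<in> space lebesgue. \<not> (s \<le> t \<longrightarrow> ((\<lambda>t. flow s t z) has_vector_derivative ?v t) (at t within {s..}))}"
      then have "s \<le> t" and nd: "\<not> ((\<lambda>t. flow s t z) has_vector_derivative ?v t) (at t within {s..})"
        by auto
      obtain n :: nat where n: "t - s < real n" using reals_Archimedean2 by blast
      have "\<not> ((\<lambda>t. integral {s..t} ?v) has_vector_derivative ?v t) (at t within {s..s + real n})"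
      proof
        assume "((\<lambda>t. integral {s..t} ?v) has_vector_derivative ?v t) (at t within {s..s + real n})"
        then have "((\<lambda>t. z + integral {s..t} ?v) has_vector_derivative ?v t) (at t within {s..s + real n})"
          by (auto intro!: derivative_eq_intros)
        then have "((\<lambda>t. flow s t z) has_vector_derivative ?v t) (at t within {s..s + real n})"
          by (rule has_vector_derivative_transform[rotated 2])
             (use \<open>s \<le> t\<close> n flow_integral_equation[OF z] in auto)
        moreover have "at t within {s..s + real n} = at t within {s..}"
          by (rule at_within_nhd[of t "{..<s + real n}"]) (use n in auto)
        ultimately show False using nd by simp
      qed
      then have "t \<in> N n" using \<open>s \<le> t\<close> n by (simp add: N_def)
      then show "t \<in> (\<Union>n. N n)" by blast
    qed
  qed
qed

text \<open>
  The map \<open>flow s (s + 1) - C1\<close> still maps the right half-plane to itself, because the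
  real part grows by at least \<open>C1\<close> in unit time. Schwarz-Pick for it is sharper than for
  \<open>flow s (s + 1)\<close> by the factors \<open>1 - C1 / Re (flow s (s + 1) z)\<close> and
  \<open>1 - C1 / Re (flow s (s + 1) w)\<close>, each of which is at most \<open>exp (- (C1 / R))\<close>.
\<close>

lemma flow_unit_step_contracts:
  assumes z: "0 < Re z" "Re (flow s (s + 1) z) \<le> R" and w: "0 < Re w" "Re (flow s (s + 1) w) \<le> R"
  shows "(cmod (flow s (s + 1) z - flow s (s + 1) w))\<^sup>2 * (Re z * Re w)
    \<le> (cmod (z - w))\<^sup>2 * exp (- 2 * (C1 / R)) * (Re (flow s (s + 1) z) * Re (flow s (s + 1) w))"
proof -
  let ?f = "flow s (s + 1)"
  have R: "R > 0" using flow_Re_pos[of z s "s + 1"] z by simp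
  have "(cmod ((?f z - of_real C1) - (?f w - of_real C1)))\<^sup>2 * (Re z * Re w)
      \<le> (cmod (z - w))\<^sup>2 * (Re (?f z - of_real C1) * Re (?f w - of_real C1))"
  proof (rule schwarz_pick_half_plane[OF _ _ z(1) w(1)])
    show "(\<lambda>z. ?f z - of_real C1) holomorphic_on right_half_plane"
      using flow_holomorphic[of s "s + 1"] by (intro holomorphic_intros) auto
    show "0 < Re (?f z - of_real C1)" if "0 < Re z" for z
      using flow_Re_bounds(1)[OF that, of s "s + 1"] that by simp
  qed
  also have "\<dots> \<le> (cmod (z - w))\<^sup>2 * ((exp (- (C1 / R)) * Re (?f z)) * (exp (- (C1 / R)) * Re (?f w)))"
  proof -
    have "0 \<le> Re (?f z) - C1 \<and> Re (?f z) - C1 \<le> exp (- (C1 / R)) * Re (?f z)"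
      if "0 < Re z" "Re (?f z) \<le> R" for z
    proof -
      have pos: "0 < Re (?f z)" using flow_Re_pos[of z s "s + 1"] that by simp
      have "C1 / R * Re (?f z) \<le> C1 / R * R" using that C1_pos R by (intro mult_left_mono) auto
      then have "Re (?f z) - C1 \<le> (1 + (- (C1 / R))) * Re (?f z)" using R by (simp add: algebra_simps)
      also have "\<dots> \<le> exp (- (C1 / R)) * Re (?f z)"
        using pos by (intro mult_right_mono exp_ge_add_one_self) auto
      finally show ?thesis using flow_Re_bounds(1)[OF that(1), of s "s + 1"] that by simp
    qed
    from this[OF z] this[OF w] show ?thesis by (intro mult_left_mono mult_mono) auto
  qed
  also have "\<dots> = (cmod (z - w))\<^sup>2 * (exp (- (C1 / R)) * exp (- (C1 / R))) * (Re (?f z) * Re (?f w))"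
    by (simp only: ac_simps)
  also have "exp (- (C1 / R)) * exp (- (C1 / R)) = exp (- 2 * (C1 / R))"
    by (simp add: exp_add[symmetric])
  finally show ?thesis by simp
qed

text \<open>
  At time \<open>s + n + 1\<close> the real parts are at most \<open>R + C2 * (n + 1)\<close>, hence at most
  \<open>(R + C2) * (n + 1)\<close>. So the step from \<open>n\<close> to \<open>n + 1\<close> contributes \<open>2 * C1 / ((R + C2) * (n + 1))\<close>
  to the exponent, and these contributions add up to a multiple of a harmonic number.
\<close>

lemma flow_distance_bound:
  assumes z: "0 < Re z" "Re z \<le> R" and w: "0 < Re w" "Re w \<le> R"
  shows "(cmod (flow s (s + real n) z - flow s (s + real n) w))\<^sup>2 * (Re z * Re w)
    \<le> (cmod (z - w))\<^sup>2 * exp (- 2 * (C1 / (R + C2)) * harm n)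
      * (Re (flow s (s + real n) z) * Re (flow s (s + real n) w))"
proof (induction n)
  case 0
  then show ?case using z w by (simp add: harm_def)
next
  case (Suc n)
  define t where "t = s + real n"
  have t: "s \<le> t" by (simp add: t_def)
  have Suc_t: "s + real (Suc n) = t + 1" by (simp add: t_def)
  define a b where "a = flow s t z" "b = flow s t w"
  have ab: "0 < Re a" "0 < Re b" using flow_Re_pos t z w by (auto simp: a_b_def)
  have step: "flow t (t + 1) a = flow s (t + 1) z" "flow t (t + 1) b = flow s (t + 1) w"
    using flow_semigroup t z w by (auto simp: a_b_def)
  define R' where "R' = R + C2 * (real n + 1)"
  have R': "Re (flow t (t + 1) a) \<le> R'" "Re (flow t (t + 1) b) \<le> R'"
    unfolding step using flow_Re_bounds(2)[OF z(1), of s "t + 1"] flow_Re_bounds(2)[OF w(1), of s "t + 1"] z w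
    by (auto simp: R'_def t_def algebra_simps)
  have Rp: "R > 0" "R' > 0" "R + C2 > 0" using z C2_pos by (auto simp: R'_def intro!: add_pos_nonneg)
  let ?Q = "(cmod (flow t (t + 1) a - flow t (t + 1) b))\<^sup>2" and ?P = "Re (flow t (t + 1) a) * Re (flow t (t + 1) b)"
  have P: "0 < ?P" using flow_Re_pos[of _ t "t + 1"] ab by simp
  define E where "E = exp (- 2 * (C1 / (R + C2)) * harm n)"
  have "exp (- 2 * (C1 / R')) \<le> exp (- 2 * (C1 / (R + C2)) * inverse (real (Suc n)))"
  proof -
    have "R' \<le> (R + C2) * real (Suc n)" using Rp C2_pos by (simp add: R'_def algebra_simps)
    then have "C1 / ((R + C2) * real (Suc n)) \<le> C1 / R'" using C1_pos Rp by (intro divide_left_mono) auto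
    then show ?thesis by (simp add: divide_inverse)
  qed
  then have E': "E * exp (- 2 * (C1 / R')) \<le> exp (- 2 * (C1 / (R + C2)) * harm (Suc n))"
    unfolding E_def harm_Suc distrib_left exp_add by (intro mult_left_mono) auto
  have "?Q * (Re a * Re b) * (Re z * Re w) \<le> ((cmod (a - b))\<^sup>2 * exp (- 2 * (C1 / R')) * ?P) * (Re z * Re w)"
    using z w by (intro mult_right_mono flow_unit_step_contracts[OF ab(1) R'(1) ab(2) R'(2)]) auto
  also have "\<dots> = ((cmod (a - b))\<^sup>2 * (Re z * Re w)) * (exp (- 2 * (C1 / R')) * ?P)"
    by (simp only: ac_simps)
  also have "\<dots> \<le> ((cmod (z - w))\<^sup>2 * E * (Re a * Re b)) * (exp (- 2 * (C1 / R')) * ?P)"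
    using Suc.IH P unfolding a_b_def t_def E_def by (intro mult_right_mono) auto
  also have "\<dots> = (cmod (z - w))\<^sup>2 * (E * exp (- 2 * (C1 / R'))) * ?P * (Re a * Re b)"
    by (simp only: ac_simps)
  also have "\<dots> \<le> (cmod (z - w))\<^sup>2 * exp (- 2 * (C1 / (R + C2)) * harm (Suc n)) * ?P * (Re a * Re b)"
    using P ab by (intro mult_right_mono mult_left_mono E') auto
  finally have "(?Q * (Re z * Re w)) * (Re a * Re b)
      \<le> ((cmod (z - w))\<^sup>2 * exp (- 2 * (C1 / (R + C2)) * harm (Suc n)) * ?P) * (Re a * Re b)"
    by (simp only: ac_simps)
  then show ?case
    using ab mult_right_le_imp_le[of "?Q * (Re z * Re w)" "Re a * Re b"] unfolding Suc_t step by simp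
qed

text \<open>
  The real parts grow linearly, the hyperbolic distance tends to zero, and the Euclidean
  distance is controlled by their product.
\<close>

lemma flow_distance_sublinear:
  assumes z: "0 < Re z" and w: "0 < Re w"
  shows "(\<lambda>n. cmod (flow s (s + real n) z - flow s (s + real n) w) / real n) \<longlonglongrightarrow> 0"
proof -
  define R where "R = max (Re z) (Re w)"
  have R: "Re z \<le> R" "Re w \<le> R" "0 < R" using z by (auto simp: R_def)
  define c where "c = C1 / (R + C2)"
  have c: "c > 0" using C1_pos C2_pos R by (simp add: c_def)
  define K where "K = cmod (z - w) / sqrt (Re z * Re w)"
  have bound: "cmod (flow s (s + real n) z - flow s (s + real n) w) \<le> K * exp (- c * harm n) * (R + C2 * real n)" for n
  proof -
    let ?a = "flow s (s + real n) z" and ?b = "flow s (s + real n) w"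
    have ab: "0 < Re ?a" "0 < Re ?b" "Re ?a \<le> R + C2 * real n" "Re ?b \<le> R + C2 * real n"
      using flow_Re_pos[of _ s "s + real n"] flow_Re_bounds(2)[of _ s "s + real n"] z w R by fastforce+
    have "(cmod (?a - ?b))\<^sup>2 * (Re z * Re w) \<le> (cmod (z - w))\<^sup>2 * exp (- 2 * c * harm n) * (Re ?a * Re ?b)"
      using flow_distance_bound[OF z R(1) w R(2)] unfolding c_def by simp
    also have "\<dots> \<le> (cmod (z - w))\<^sup>2 * exp (- 2 * c * harm n) * ((R + C2 * real n) * (R + C2 * real n))"
      using ab by (intro mult_left_mono mult_mono) auto
    finally have "(cmod (?a - ?b))\<^sup>2 \<le> (cmod (z - w))\<^sup>2 * exp (- 2 * c * harm n) * ((R + C2 * real n) * (R + C2 * real n)) / (Re z * Re w)"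
      using z w by (simp add: pos_le_divide_eq)
    also have "\<dots> = (K * exp (- c * harm n) * (R + C2 * real n))\<^sup>2"
    proof -
      have "exp (- 2 * c * harm n) = (exp (- c * harm n))\<^sup>2"
        by (simp add: power2_eq_square exp_add[symmetric])
      moreover have "K\<^sup>2 = (cmod (z - w))\<^sup>2 / (Re z * Re w)"
        using z w by (simp add: K_def power_divide)
      moreover have "(K * exp (- c * harm n) * (R + C2 * real n))\<^sup>2
          = K\<^sup>2 * (exp (- c * harm n))\<^sup>2 * ((R + C2 * real n) * (R + C2 * real n))"
        by (simp add: power_mult_distrib power2_eq_square)
      ultimately show ?thesis by (simp only: times_divide_eq_left)
    qed
    finally show ?thesis
      by (rule power2_le_imp_le) (use z w R C2_pos in \<open>auto simp: K_def intro!: mult_nonneg_nonneg\<close>)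
  qed
  have harm: "filterlim (\<lambda>n. harm n :: real) at_top sequentially" by (rule harm_at_top)
  have "filterlim (\<lambda>n. c * harm n) at_top sequentially"
    by (rule filterlim_tendsto_pos_mult_at_top[OF tendsto_const c harm])
  then have "filterlim (\<lambda>n. - (c * harm n)) at_bot sequentially"
    by (simp add: filterlim_uminus_at_top)
  then have "(\<lambda>n. exp (- (c * harm n))) \<longlonglongrightarrow> 0"
    by (rule filterlim_compose[OF exp_at_bot])
  then have "(\<lambda>n. K * exp (- c * harm n) * (R * inverse (real n) + C2)) \<longlonglongrightarrow> K * 0 * (R * 0 + C2)"
    by (intro tendsto_intros lim_inverse_n) simp
  then have lim: "(\<lambda>n. K * exp (- c * harm n) * (R * inverse (real n) + C2)) \<longlonglongrightarrow> 0" by simp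
  show ?thesis
  proof (rule Lim_null_comparison[OF _ lim])
    show "\<forall>\<^sub>F n in sequentially. norm (cmod (flow s (s + real n) z - flow s (s + real n) w) / real n)
        \<le> K * exp (- c * harm n) * (R * inverse (real n) + C2)"
      using eventually_gt_at_top[of 0]
    proof eventually_elim
      case (elim n)
      have "cmod (flow s (s + real n) z - flow s (s + real n) w) / real n
          \<le> K * exp (- c * harm n) * (R + C2 * real n) / real n"
        by (rule divide_right_mono[OF bound]) simp
      also have "\<dots> = K * exp (- c * harm n) * (R * inverse (real n) + C2)"
        using elim by (simp add: field_simps)
      finally show ?case by simp
    qed
  qed
qed

end

section \<open>Reductions of the hypotheses\<close>

lemma abs_continuous_on_subinterval:
  assumes ac: "abs_continuous_on_interval a b f" and sub: "a \<le> c" "d \<le> b"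
  shows "abs_continuous_on_interval c d f"
  unfolding abs_continuous_on_interval_def
proof (intro allI impI)
  fix \<epsilon> :: real assume "\<epsilon> > 0"
  with ac obtain \<delta> where "\<delta> > 0" and \<delta>: "\<forall>(n::nat) u v.
        (\<forall>i<n. a \<le> u i \<and> u i \<le> v i \<and> v i \<le> b) \<longrightarrow>
        disjoint_family_on (\<lambda>i. {u i<..<v i}) {..<n} \<longrightarrow>
        (\<Sum>i<n. v i - u i) < \<delta> \<longrightarrow> (\<Sum>i<n. norm (f (v i) - f (u i))) < \<epsilon>"
    unfolding abs_continuous_on_interval_def by blast
  show "\<exists>\<delta>>0. \<forall>(n::nat) u v.
        (\<forall>i<n. c \<le> u i \<and> u i \<le> v i \<and> v i \<le> d) \<longrightarrow>
        disjoint_family_on (\<lambda>i. {u i<..<v i}) {..<n} \<longrightarrow>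
        (\<Sum>i<n. v i - u i) < \<delta> \<longrightarrow> (\<Sum>i<n. norm (f (v i) - f (u i))) < \<epsilon>"
  proof (intro exI[of _ \<delta>] conjI allI impI \<open>\<delta> > 0\<close>)
    fix n :: nat and u v :: "nat \<Rightarrow> real"
    assume 1: "\<forall>i<n. c \<le> u i \<and> u i \<le> v i \<and> v i \<le> d"
      and 2: "disjoint_family_on (\<lambda>i. {u i<..<v i}) {..<n}" "(\<Sum>i<n. v i - u i) < \<delta>"
    have "\<forall>i<n. a \<le> u i \<and> u i \<le> v i \<and> v i \<le> b" using 1 sub by (meson order_trans)
    with \<delta> 2 show "(\<Sum>i<n. norm (f (v i) - f (u i))) < \<epsilon>" by blast
  qed
qed

lemma negligible_of_AE:
  assumes "AE x in lebesgue. P x"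
  obtains N where "negligible N" "\<And>x. x \<notin> N \<Longrightarrow> P x"
proof -
  obtain N where "{x \<in> space lebesgue. \<not> P x} \<subseteq> N" "emeasure lebesgue N = 0" "N \<in> sets lebesgue"
    using AE_E[OF assms] by blast
  then show ?thesis by (intro that[of N]) (auto simp: negligible_iff_null_sets null_sets_def)
qed

text \<open>
  A Herglotz function is holomorphic in \<open>z\<close> only at almost every time. Replacing it by a
  constant in the middle of the strip at the exceptional times, and at negative times, gives a field
  that is holomorphic at every time, without affecting any of the differential equations.
\<close>

lemma strip_field_of_herglotz_function:
  assumes p: "herglotz_function p" and C: "0 < C1" "C1 < C2"
    and strip: "\<And>z t. z \<in> right_half_plane \<Longrightarrow> 0 \<le> t \<Longrightarrow> C1 < Re (p z t) \<and> Re (p z t) < C2"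
  obtains q where "strip_field q C1 C2"
    "AE t in lebesgue. 0 \<le> t \<longrightarrow> (\<forall>z. q z t = p z t)"
proof -
  define q where "q z t = (if 0 \<le> t \<and> (\<lambda>z. p z t) holomorphic_on right_half_plane
      then p z t else of_real ((C1 + C2) / 2))" for z t
  have hol: "AE t in lebesgue. 0 \<le> t \<longrightarrow> (\<lambda>z. p z t) holomorphic_on right_half_plane"
    and int: "\<And>z. 0 < Re z \<Longrightarrow> locally_integrable (p z)"
    using p unfolding herglotz_function_def by auto
  have "strip_field q C1 C2"
  proof
    show "(\<lambda>z. q z t) holomorphic_on right_half_plane" for t
      by (cases "0 \<le> t \<and> (\<lambda>z. p z t) holomorphic_on right_half_plane") (auto simp: q_def)
    show "C1 < Re (q z t) \<and> Re (q z t) < C2" if "0 < Re z" for z t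
      using strip[of z t] that C by (auto simp: q_def)
    show "q z absolutely_integrable_on {a..b}" if z: "0 < Re z" for z a b
    proof -
      obtain N where N: "negligible N" "\<And>t. t \<notin> N \<Longrightarrow> 0 \<le> t \<longrightarrow> (\<lambda>z. p z t) holomorphic_on right_half_plane"
        using negligible_of_AE[OF hol] by blast
      have "p z absolutely_integrable_on {0..max 0 b}"
        using int[OF z] unfolding locally_integrable_def by simp
      then have r: "q z absolutely_integrable_on {0..max 0 b}"
        by (rule absolutely_integrable_spike[OF _ N(1)]) (use N(2) in \<open>auto simp: q_def\<close>)
      have "(\<lambda>t. of_real ((C1 + C2) / 2) :: complex) absolutely_integrable_on {min 0 a..0}"
        by (intro absolutely_integrable_on_const) simp
      then have l: "q z absolutely_integrable_on {min 0 a..0}"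
        by (rule absolutely_integrable_spike[OF _ negligible_sing[of 0]]) (auto simp: q_def)
      have "q z absolutely_integrable_on {min 0 a..max 0 b}"
        by (rule absolutely_integrable_on_combine[OF l r]) auto
      then show ?thesis by (rule absolutely_integrable_on_subinterval) auto
    qed
  qed (rule C)
  moreover have "AE t in lebesgue. 0 \<le> t \<longrightarrow> (\<forall>z. q z t = p z t)"
    using hol by eventually_elim (auto simp: q_def)
  ultimately show ?thesis by (rule that)
qed

lemma univalent_disks_of_Liminf:
  assumes a: "0 < a" and "0 < C1"
    and lim: "0 < Liminf at_top (\<lambda>t::real.
           INF z\<in>half_plane (a + C1 * t). radius_of_univalence D (h t) z / ereal (Re z))"
  obtains c T1 where "0 < c"
    "\<And>T z. T1 \<le> T \<Longrightarrow> a + C1 * T < Re z \<Longrightarrow> inj_on (h T) (ball z (c * Re z))"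
proof -
  obtain y where y: "0 < y" "y < Liminf at_top (\<lambda>t::real.
           INF z\<in>half_plane (a + C1 * t). radius_of_univalence D (h t) z / ereal (Re z))"
    using dense[OF lim] by blast
  then obtain c where c: "y = ereal c" "0 < c" by (cases y) auto
  have "eventually (\<lambda>t. y < (INF z\<in>half_plane (a + C1 * t). radius_of_univalence D (h t) z / ereal (Re z))) at_top"
    by (rule less_LiminfD[OF y(2)])
  then obtain T0 where T0: "\<And>t. T0 \<le> t \<Longrightarrow> y < (INF z\<in>half_plane (a + C1 * t). radius_of_univalence D (h t) z / ereal (Re z))"
    by (auto simp: eventually_at_top_linorder)
  show ?thesis
  proof (rule that[of c "max 0 T0"])
    fix T z assume T: "max 0 T0 \<le> T" and z: "a + C1 * T < Re z"
    have Rez: "0 < Re z" using a \<open>0 < C1\<close> T z by (smt (verit) mult_nonneg_nonneg max.bounded_iff)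
    have "y < (INF z\<in>half_plane (a + C1 * T). radius_of_univalence D (h T) z / ereal (Re z))"
      using T0 T by simp
    also have "\<dots> \<le> radius_of_univalence D (h T) z / ereal (Re z)"
      by (rule INF_lower) (use z in simp)
    finally have "ereal (Re z) * y < radius_of_univalence D (h T) z"
      using Rez by (subst (asm) ereal_less_divide_pos) auto
    then have "ereal (c * Re z) < radius_of_univalence D (h T) z" by (simp add: c mult.commute)
    then obtain r where r: "r \<in> insert 0 {r. 0 < r \<and> ball z r \<subseteq> D \<and> inj_on (h T) (ball z r)}" "c * Re z < r"
      unfolding radius_of_univalence_def less_SUP_iff by auto
    have "0 < c * Re z" using c Rez by simp
    with r have "inj_on (h T) (ball z r)" by auto
    then show "inj_on (h T) (ball z (c * Re z))"
      by (rule inj_on_subset) (rule subset_ball, use r in simp)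
  qed (rule c(2))
qed

text \<open>
  The constants \<open>B N\<close> may grow with the time horizon \<open>N\<close>, while a Loewner chain needs one
  integrable majorant for all times: on the time interval from \<open>N\<close> to \<open>N + 1\<close> it uses the
  constant of the horizon \<open>N + 1\<close>.
\<close>

lemma integral_bound_glue:
  fixes G :: "'z \<Rightarrow> real \<Rightarrow> complex" and m :: "real \<Rightarrow> real"
  assumes m: "\<And>a b. 0 \<le> a \<Longrightarrow> m integrable_on {a..b}" "\<And>u. 0 \<le> m u"
    and B: "\<And>N. 0 \<le> B N"
    and bound: "\<And>N z s t. z \<in> K \<Longrightarrow> 0 \<le> s \<Longrightarrow> s \<le> t \<Longrightarrow> t \<le> real N \<Longrightarrow>
        cmod (G z s - G z t) \<le> B N * integral {s..t} m"
  obtains k where "\<And>u. 0 \<le> k u" "locally_integrable k"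
    "\<And>z s t. z \<in> K \<Longrightarrow> 0 \<le> s \<Longrightarrow> s \<le> t \<Longrightarrow> cmod (G z s - G z t) \<le> (LINT u:{s..t}|lebesgue. k u)"
proof -
  define k where "k u = B (Suc (nat \<lfloor>u\<rfloor>)) * m u" for u
  have k0: "0 \<le> k u" for u using B m(2) by (simp add: k_def)
  have piece: "(k has_integral B (Suc n) * integral {s..t} m) {s..t}" if "real n \<le> s" "t \<le> real (Suc n)" for n s t
  proof (rule has_integral_spike[OF negligible_sing[of "real (Suc n)"]])
    fix u assume "u \<in> {s..t} - {real (Suc n)}"
    then have "real n \<le> u" "u < real (Suc n)" using that by auto
    then have "nat \<lfloor>u\<rfloor> = n" by linarith
    then show "k u = B (Suc n) * m u" by (simp add: k_def)
  next
    have "m integrable_on {s..t}" using m(1) that by simp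
    then show "((\<lambda>u. B (Suc n) * m u) has_integral B (Suc n) * integral {s..t} m) {s..t}"
      by (intro has_integral_mult_right integrable_integral)
  qed
  have kint0: "k integrable_on {0..real n}" for n
  proof (induction n)
    case (Suc n)
    show ?case
      by (rule Henstock_Kurzweil_Integration.integrable_combine[OF _ _ Suc has_integral_integrable[OF piece[OF order_refl order_refl]]]) auto
  qed (use has_integral_refl(2) in \<open>force simp: integrable_on_def\<close>)
  have kint: "k integrable_on {s..t}" if "0 \<le> s" for s t
  proof -
    obtain n :: nat where "t \<le> real n" using real_arch_simple by blast
    then show ?thesis using integrable_on_subinterval[OF kint0[of n]] that by simp
  qed
  have kabs: "k absolutely_integrable_on {s..t}" if "0 \<le> s" for s t
    using kint[OF that] k0 by (intro nonnegative_absolutely_integrable_1)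
  have est: "cmod (G z s - G z t) \<le> integral {s..t} k"
    if z: "z \<in> K" and "0 \<le> s" "s \<le> t" "t \<le> real n" for z s t n
    using that(2-)
  proof (induction n arbitrary: t)
    case 0
    then have "s = 0" "t = 0" by simp_all
    then show ?case by (simp add: integral_refl)
  next
    case (Suc n)
    consider "t \<le> real n" | "real n \<le> s" | "s \<le> real n" "real n \<le> t" by linarith
    then show ?case
    proof cases
      case 1
      then show ?thesis using Suc by simp
    next
      case 2
      have "integral {s..t} k = B (Suc n) * integral {s..t} m"
        by (rule integral_unique[OF piece[OF 2 Suc.prems(3)]])
      then show ?thesis using bound[OF z Suc.prems] by simp
    next
      case 3
      have "integral {real n..t} k = B (Suc n) * integral {real n..t} m"
        by (rule integral_unique[OF piece[OF order_refl Suc.prems(3)]])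
      then have "cmod (G z (real n) - G z t) \<le> integral {real n..t} k"
        using bound[OF z _ 3(2) Suc.prems(3)] by simp
      moreover have "cmod (G z s - G z (real n)) \<le> integral {s..real n} k"
        using Suc.IH[of "real n"] Suc.prems 3 by simp
      moreover have "integral {s..real n} k + integral {real n..t} k = integral {s..t} k"
        by (rule Henstock_Kurzweil_Integration.integral_combine[OF 3 kint[OF Suc.prems(1)]])
      ultimately show ?thesis
        using norm_triangle_ineq[of "G z s - G z (real n)" "G z (real n) - G z t"] by simp
    qed
  qed
  show ?thesis
  proof (rule that[OF k0])
    show "locally_integrable k" unfolding locally_integrable_def using kabs by blast
    fix z s t assume as: "z \<in> K" "0 \<le> s" "s \<le> (t::real)"
    obtain n :: nat where "t \<le> real n" using real_arch_simple by blast
    from est[OF as this] show "cmod (G z s - G z t) \<le> (LINT u:{s..t}|lebesgue. k u)"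
      by (simp add: set_lebesgue_integral_eq_integral(2)[OF kabs[OF as(2)]])
  qed
qed

section \<open>The transported maps and the Loewner chain\<close>

context strip_field
begin

text \<open>
  The exceptional null set in the equation for \<open>h\<close> depends on \<open>z\<close> and might contain every
  time at the moving point \<open>flow s t z\<close>, so the chain rule is not available along a trajectory.
  Instead, over a short time interval, the increment of \<open>h t (flow s t z)\<close> is split into a change
  in time at a fixed point, given by integrating the equation at that point, and a change in space
  at a fixed time, given by the derivative of \<open>h\<close>. To first order they cancel, and continuity of
  \<open>deriv (h t) z\<close> in both variables makes the error an arbitrarily small multiple of an integral.
\<close>

lemma transport_along_flow:
  assumes x0: "0 \<le> x0"
    and hol: "\<And>t. 0 \<le> t \<Longrightarrow> h t holomorphic_on half_plane x0"
    and cont: "continuous_on (half_plane x0 \<times> {0..}) (\<lambda>(z, t). h t z)"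
    and ac: "\<And>z. z \<in> half_plane x0 \<Longrightarrow> locally_abs_continuous_from 0 (\<lambda>t. h t z)"
    and pde: "\<And>z. z \<in> half_plane x0 \<Longrightarrow> AE t in lebesgue. 0 \<le> t \<longrightarrow>
             ((\<lambda>t. h t z) has_vector_derivative - deriv (h t) z * q z t) (at t within {0..})"
    and z: "x0 < Re z" and st: "0 \<le> s" "s \<le> t"
  shows "h t (flow s t z) = h s z"
proof -
  have z0: "0 < Re z" using x0 z by simp
  define y where "y u = flow s u z" for u
  have y: "continuous_on {s..t} y" unfolding y_def by (rule flow_continuous[OF z0])
  have yRe: "Re z \<le> Re (y u)" if "s \<le> u" for u using flow_Re_ge[OF z0 that] by (simp add: y_def)
  have "bounded (y ` {s..t})" using y by (intro compact_imp_bounded compact_continuous_image) auto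
  then obtain R where R: "\<And>u. u \<in> {s..t} \<Longrightarrow> cmod (y u) \<le> R" unfolding bounded_iff by blast
  define Q where "Q = {\<zeta>. Re z \<le> Re \<zeta>} \<inter> cball 0 R"
  have Q: "compact Q" "convex Q"
    unfolding Q_def by (auto intro: closed_Int_compact closed_halfspace_Re_ge convex_Int convex_halfspace_Re_ge)
  have yQ: "y u \<in> Q" if "u \<in> {s..t}" for u using R[OF that] yRe that by (auto simp: Q_def)
  have Qx0: "Q \<subseteq> half_plane x0" using z by (auto simp: Q_def)
  define dh where "dh \<zeta> u = deriv (h u) \<zeta>" for \<zeta> u
  have "continuous_on (half_plane x0 \<times> {0..}) (\<lambda>(\<zeta>, u). dh \<zeta> u)"
    unfolding dh_def by (rule continuous_on_deriv_of_family[OF open_half_plane hol cont]) auto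
  then have dhc: "continuous_on (Q \<times> {s..t}) (\<lambda>(\<zeta>, u). dh \<zeta> u)"
    by (rule continuous_on_subset) (use Qx0 st in auto)
  have cpt: "compact (Q \<times> {s..t})" using Q by (intro compact_Times) auto
  have dhu: "uniformly_continuous_on (Q \<times> {s..t}) (\<lambda>(\<zeta>, u). dh \<zeta> u)"
    by (rule compact_uniformly_continuous[OF dhc cpt])
  have yu: "uniformly_continuous_on {s..t} y" by (rule compact_uniformly_continuous[OF y]) auto
  have "bounded ((\<lambda>(\<zeta>, u). dh \<zeta> u) ` (Q \<times> {s..t}))"
    by (intro compact_imp_bounded compact_continuous_image dhc cpt)
  then obtain B where B: "\<And>\<zeta> u. \<zeta> \<in> Q \<Longrightarrow> u \<in> {s..t} \<Longrightarrow> cmod (dh \<zeta> u) \<le> B"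
    unfolding bounded_iff by force
  have B0: "0 \<le> B" using B[OF yQ, of s s] st by (auto intro: order_trans[OF norm_ge_zero])
  define L where "L = C2 / Re z"
  have L: "L > 0" using C2_pos z0 by (simp add: L_def)
  define k where "k u = cmod (q (y u) u)" for u
  have kint: "k integrable_on {a..b}" if "s \<le> a" for a b
    unfolding k_def y_def by (rule flow_integrable_on(2)[OF z0 that])
  \<comment> \<open>One \<open>k\<close> bounds the linearisation error in space, the other \<open>k\<close> and \<open>B * L\<close> the uncancelled rest of the two integrals.\<close>
  define G where "G \<tau> = integral {s..\<tau>} (\<lambda>u. 2 * k u + B * L)" for \<tau>
  have Gint: "(\<lambda>u. 2 * k u + B * L) integrable_on {a..b}" if "s \<le> a" for a b
    using kint[OF that] by (intro integrable_add integrable_on_mult_right integrable_const_ivl)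
  have "h t (y t) = h s (y s)"
  proof (rule equal_endpoints_if_infinitesimal_increments[OF st(2), where G = G])
    fix \<epsilon> :: real assume \<epsilon>: "\<epsilon> > 0"
    obtain \<delta>1 where \<delta>1: "\<delta>1 > 0" "\<And>\<zeta> u \<zeta>' u'. \<zeta> \<in> Q \<Longrightarrow> u \<in> {s..t} \<Longrightarrow> \<zeta>' \<in> Q \<Longrightarrow> u' \<in> {s..t} \<Longrightarrow>
        dist (\<zeta>', u') (\<zeta>, u) < \<delta>1 \<Longrightarrow> cmod (dh \<zeta>' u' - dh \<zeta> u) < \<epsilon>"
    proof -
      obtain \<delta>1 where "\<delta>1 > 0" and d: "\<And>x x'. x \<in> Q \<times> {s..t} \<Longrightarrow> x' \<in> Q \<times> {s..t} \<Longrightarrow> dist x' x < \<delta>1 \<Longrightarrow>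
          dist (case x' of (\<zeta>, u) \<Rightarrow> dh \<zeta> u) (case x of (\<zeta>, u) \<Rightarrow> dh \<zeta> u) < \<epsilon>"
        using dhu \<epsilon> unfolding uniformly_continuous_on_def by blast
      show ?thesis
      proof (rule that[OF \<open>\<delta>1 > 0\<close>])
        fix \<zeta> u \<zeta>' u' assume "\<zeta> \<in> Q" "u \<in> {s..t}" "\<zeta>' \<in> Q" "u' \<in> {s..t}" "dist (\<zeta>', u') (\<zeta>, u) < \<delta>1"
        then show "cmod (dh \<zeta>' u' - dh \<zeta> u) < \<epsilon>" using d[of "(\<zeta>,u)" "(\<zeta>',u')"] by (simp add: dist_norm)
      qed
    qed
    have "min \<delta>1 \<epsilon> > 0" using \<delta>1 \<epsilon> by simp
    then obtain \<delta>2 where \<delta>2: "\<delta>2 > 0" "\<And>u u'. u \<in> {s..t} \<Longrightarrow> u' \<in> {s..t} \<Longrightarrow> dist u' u < \<delta>2 \<Longrightarrow> dist (y u') (y u) < min \<delta>1 \<epsilon>"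
      using yu unfolding uniformly_continuous_on_def by metis
    show "\<exists>\<delta>>0. \<forall>\<sigma> \<tau>. s \<le> \<sigma> \<longrightarrow> \<sigma> \<le> \<tau> \<longrightarrow> \<tau> \<le> t \<longrightarrow> \<tau> - \<sigma> < \<delta> \<longrightarrow>
        cmod (h \<tau> (y \<tau>) - h \<sigma> (y \<sigma>)) \<le> \<epsilon> * (G \<tau> - G \<sigma>)"
    proof (intro exI[of _ "min \<delta>1 \<delta>2"] conjI allI impI)
      show "min \<delta>1 \<delta>2 > 0" using \<delta>1 \<delta>2 by simp
      fix \<sigma> \<tau> assume \<sigma>\<tau>: "s \<le> \<sigma>" "\<sigma> \<le> \<tau>" "\<tau> \<le> t" "\<tau> - \<sigma> < min \<delta>1 \<delta>2"
      have ycl: "dist (y u) (y \<sigma>) < \<delta>1" "cmod (y u - y \<sigma>) < \<epsilon>" if "u \<in> {\<sigma>..\<tau>}" for u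
        using \<delta>2(2)[of \<sigma> u] that \<sigma>\<tau> by (auto simp: dist_real_def dist_norm)
      have \<sigma>Q: "y \<sigma> \<in> Q" "y \<tau> \<in> Q" using yQ \<sigma>\<tau> by auto
      define D where "D = dh (y \<sigma>) \<tau>"
      have qyint: "(\<lambda>u. q (y u) u) integrable_on {\<sigma>..\<tau>}"
        unfolding y_def by (rule flow_integrable_on(1)[OF z0 \<sigma>\<tau>(1)])
      have yinc: "y \<tau> - y \<sigma> = integral {\<sigma>..\<tau>} (\<lambda>u. q (y u) u)"
        unfolding y_def by (rule flow_increment[OF z0 \<sigma>\<tau>(1,2)])
      have yinc_le: "cmod (y \<tau> - y \<sigma>) \<le> integral {\<sigma>..\<tau>} k"
        unfolding yinc by (rule integral_norm_bound_integral[OF qyint kint[OF \<sigma>\<tau>(1)]]) (simp add: k_def)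
      have space: "cmod (h \<tau> (y \<tau>) - h \<tau> (y \<sigma>) - D * (y \<tau> - y \<sigma>)) \<le> \<epsilon> * integral {\<sigma>..\<tau>} k"
      proof -
        have seg: "closed_segment (y \<sigma>) (y \<tau>) \<subseteq> Q" using \<sigma>Q Q(2) by (simp add: closed_segment_subset)
        have "cmod ((h \<tau> (y \<tau>) - D * y \<tau>) - (h \<tau> (y \<sigma>) - D * y \<sigma>)) \<le> \<epsilon> * cmod (y \<tau> - y \<sigma>)"
        proof (rule field_differentiable_bound[where S = "closed_segment (y \<sigma>) (y \<tau>)" and f' = "\<lambda>\<zeta>. dh \<zeta> \<tau> - D"])
          fix \<zeta> assume \<zeta>: "\<zeta> \<in> closed_segment (y \<sigma>) (y \<tau>)"
          then have \<zeta>Q: "\<zeta> \<in> Q" using seg by blast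
          have "\<zeta> \<in> half_plane x0" "0 \<le> \<tau>" using \<zeta>Q Qx0 \<sigma>\<tau> st by auto
          then have "(h \<tau> has_field_derivative dh \<zeta> \<tau>) (at \<zeta>)"
            unfolding dh_def using holomorphic_derivI[OF hol open_half_plane] by blast
          then show "((\<lambda>\<zeta>. h \<tau> \<zeta> - D * \<zeta>) has_field_derivative dh \<zeta> \<tau> - D) (at \<zeta> within closed_segment (y \<sigma>) (y \<tau>))"
            by (auto intro!: derivative_eq_intros intro: has_field_derivative_at_within)
          have "dist \<zeta> (y \<sigma>) \<le> dist (y \<tau>) (y \<sigma>)"
            using \<zeta> by (metis dist_commute dist_in_closed_segment)
          then have "dist (\<zeta>, \<tau>) (y \<sigma>, \<tau>) < \<delta>1" using ycl(1)[of \<tau>] \<sigma>\<tau> by (simp add: dist_Pair_Pair)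
          then show "cmod (dh \<zeta> \<tau> - D) \<le> \<epsilon>"
            unfolding D_def using \<delta>1(2)[of "y \<sigma>" \<tau> \<zeta> \<tau>] \<sigma>Q \<zeta>Q \<sigma>\<tau> by (simp add: less_imp_le)
        qed auto
        also have "\<dots> \<le> \<epsilon> * integral {\<sigma>..\<tau>} k" using yinc_le \<epsilon> by simp
        finally show ?thesis by (simp add: algebra_simps)
      qed
      have y\<sigma>: "y \<sigma> \<in> half_plane x0" using \<sigma>Q Qx0 by blast
      obtain N where N: "negligible N" "\<And>u. u \<notin> N \<Longrightarrow> 0 \<le> u \<longrightarrow>
             ((\<lambda>t. h t (y \<sigma>)) has_vector_derivative - deriv (h u) (y \<sigma>) * q (y \<sigma>) u) (at u within {0..})"
        using negligible_of_AE[OF pde[OF y\<sigma>]] by blast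
      have time: "((\<lambda>u. - dh (y \<sigma>) u * q (y \<sigma>) u) has_integral (h \<tau> (y \<sigma>) - h \<sigma> (y \<sigma>))) {\<sigma>..\<tau>}"
      proof (rule has_integral_abs_continuous[OF \<sigma>\<tau>(2) _ N(1)])
        have "abs_continuous_on_interval 0 t (\<lambda>t. h t (y \<sigma>))"
          using ac[OF y\<sigma>] st unfolding locally_abs_continuous_from_def by simp
        then show "abs_continuous_on_interval \<sigma> \<tau> (\<lambda>t. h t (y \<sigma>))"
          by (rule abs_continuous_on_subinterval) (use \<sigma>\<tau> st in auto)
        fix u assume "u \<in> {\<sigma>..\<tau>} - N"
        then have "((\<lambda>t. h t (y \<sigma>)) has_vector_derivative - dh (y \<sigma>) u * q (y \<sigma>) u) (at u within {0..})"
          using N(2)[of u] \<sigma>\<tau> st by (simp add: dh_def)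
        then show "((\<lambda>t. h t (y \<sigma>)) has_vector_derivative - dh (y \<sigma>) u * q (y \<sigma>) u) (at u within {\<sigma>..\<tau>})"
          by (rule has_vector_derivative_within_subset) (use \<sigma>\<tau> st in auto)
      qed
      have "((\<lambda>u. D * q (y u) u) has_integral D * (y \<tau> - y \<sigma>)) {\<sigma>..\<tau>}"
        unfolding yinc using qyint by (intro has_integral_mult_right integrable_integral)
      from has_integral_add[OF this time]
      have sum: "((\<lambda>u. D * q (y u) u - dh (y \<sigma>) u * q (y \<sigma>) u) has_integral
          D * (y \<tau> - y \<sigma>) + (h \<tau> (y \<sigma>) - h \<sigma> (y \<sigma>))) {\<sigma>..\<tau>}" by simp
      have "cmod (D * (y \<tau> - y \<sigma>) + (h \<tau> (y \<sigma>) - h \<sigma> (y \<sigma>))) \<le> integral {\<sigma>..\<tau>} (\<lambda>u. \<epsilon> * k u + \<epsilon> * (B * L))"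
        unfolding integral_unique[OF sum, symmetric]
      proof (rule integral_norm_bound_integral)
        show "(\<lambda>u. D * q (y u) u - dh (y \<sigma>) u * q (y \<sigma>) u) integrable_on {\<sigma>..\<tau>}"
          by (rule has_integral_integrable[OF sum])
        show "(\<lambda>u. \<epsilon> * k u + \<epsilon> * (B * L)) integrable_on {\<sigma>..\<tau>}"
          using kint[OF \<sigma>\<tau>(1)] by (intro integrable_add integrable_on_mult_right integrable_const_ivl)
        fix u assume u: "u \<in> {\<sigma>..\<tau>}"
        have ust: "u \<in> {s..t}" "\<tau> \<in> {s..t}" using u \<sigma>\<tau> by auto
        have "dist (y \<sigma>, \<tau>) (y \<sigma>, u) < \<delta>1" using u \<sigma>\<tau> by (simp add: dist_Pair_Pair dist_real_def)
        then have 1: "cmod (D - dh (y \<sigma>) u) \<le> \<epsilon>"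
          unfolding D_def using \<delta>1(2)[of "y \<sigma>" u "y \<sigma>" \<tau>] \<sigma>Q ust by (simp add: less_imp_le)
        have "cmod (q (y u) u - q (y \<sigma>) u) \<le> L * cmod (y u - y \<sigma>)"
          unfolding L_def using yRe[of u] yRe[of \<sigma>] u \<sigma>\<tau> by (intro field_lipschitz z0) auto
        also have "\<dots> \<le> L * \<epsilon>" using ycl(2)[OF u] L by (intro mult_left_mono) auto
        finally have 2: "cmod (q (y u) u - q (y \<sigma>) u) \<le> L * \<epsilon>" .
        have "D * q (y u) u - dh (y \<sigma>) u * q (y \<sigma>) u
            = (D - dh (y \<sigma>) u) * q (y u) u + dh (y \<sigma>) u * (q (y u) u - q (y \<sigma>) u)"
          by (simp add: algebra_simps)
        also have "cmod \<dots> \<le> \<epsilon> * k u + B * (L * \<epsilon>)"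
          unfolding k_def
        proof (rule norm_triangle_mono)
          show "cmod ((D - dh (y \<sigma>) u) * q (y u) u) \<le> \<epsilon> * cmod (q (y u) u)"
            using 1 by (simp add: norm_mult mult_right_mono)
          show "cmod (dh (y \<sigma>) u * (q (y u) u - q (y \<sigma>) u)) \<le> B * (L * \<epsilon>)"
            unfolding norm_mult using 2 B[OF \<sigma>Q(1) ust(1)] B0 by (intro mult_mono) auto
        qed
        finally show "cmod (D * q (y u) u - dh (y \<sigma>) u * q (y \<sigma>) u) \<le> \<epsilon> * k u + \<epsilon> * (B * L)"
          by (simp add: ac_simps)
      qed
      also have "\<dots> = \<epsilon> * integral {\<sigma>..\<tau>} (\<lambda>u. k u + B * L)"
        by (simp add: distrib_left flip: integral_mult_right)
      finally have main: "cmod (D * (y \<tau> - y \<sigma>) + (h \<tau> (y \<sigma>) - h \<sigma> (y \<sigma>))) \<le> \<epsilon> * integral {\<sigma>..\<tau>} (\<lambda>u. k u + B * L)" .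
      have "integral {\<sigma>..\<tau>} k + integral {\<sigma>..\<tau>} (\<lambda>u. k u + B * L) = integral {\<sigma>..\<tau>} (\<lambda>u. k u + (k u + B * L))"
        using kint[OF \<sigma>\<tau>(1)] by (intro integral_add[symmetric] integrable_add integrable_const_ivl)
      also have "\<dots> = integral {\<sigma>..\<tau>} (\<lambda>u. 2 * k u + B * L)" by (simp add: algebra_simps)
      also have "\<dots> = G \<tau> - G \<sigma>"
        unfolding G_def
        using Henstock_Kurzweil_Integration.integral_combine[OF \<sigma>\<tau>(1,2) Gint[OF order_refl]] by simp
      finally have Geq: "integral {\<sigma>..\<tau>} k + integral {\<sigma>..\<tau>} (\<lambda>u. k u + B * L) = G \<tau> - G \<sigma>" .
      have "h \<tau> (y \<tau>) - h \<sigma> (y \<sigma>) = (h \<tau> (y \<tau>) - h \<tau> (y \<sigma>) - D * (y \<tau> - y \<sigma>))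
          + (D * (y \<tau> - y \<sigma>) + (h \<tau> (y \<sigma>) - h \<sigma> (y \<sigma>)))" by simp
      also have "cmod \<dots> \<le> \<epsilon> * integral {\<sigma>..\<tau>} k + \<epsilon> * integral {\<sigma>..\<tau>} (\<lambda>u. k u + B * L)"
        by (rule norm_triangle_mono[OF space main])
      also have "\<dots> = \<epsilon> * (G \<tau> - G \<sigma>)" unfolding Geq[symmetric] by (simp add: distrib_left)
      finally show "cmod (h \<tau> (y \<tau>) - h \<sigma> (y \<sigma>)) \<le> \<epsilon> * (G \<tau> - G \<sigma>)" .
    qed
  qed
  then show ?thesis using z0 by (simp add: y_def)
qed

lemma evolution_family_of_flow:
  assumes eq: "AE t in lebesgue. 0 \<le> t \<longrightarrow> (\<forall>z. q z t = p z t)"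
  shows "evolution_family_of p flow"
  unfolding evolution_family_of_def
proof (intro conjI allI impI ballI)
  fix s t :: real assume "0 \<le> s \<and> s \<le> t"
  then show "flow s t holomorphic_on right_half_plane" using flow_holomorphic by blast
  show "flow s t ` right_half_plane \<subseteq> right_half_plane"
    using flow_Re_pos \<open>0 \<le> s \<and> s \<le> t\<close> by auto
next
  fix z :: complex and s :: real assume "z \<in> right_half_plane" and s: "0 \<le> s"
  then have z: "0 < Re z" by simp
  show "flow s s z = z" using z by simp
  show "locally_abs_continuous_from s (\<lambda>t. flow s t z)" by (rule flow_locally_abs_continuous[OF z])
  show "AE t in lebesgue. s \<le> t \<longrightarrow>
      ((\<lambda>t. flow s t z) has_vector_derivative p (flow s t z) t) (at t within {s..})"
    using flow_derivative_AE[OF z, of s] eq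
  proof eventually_elim
    case (elim t)
    then show ?case using s by auto
  qed
qed

text \<open>
  The hypothesis on disks concerns points with real part greater than \<open>a + C1 * T\<close>, whereas
  \<open>Re (flow t T z) - C1 * T\<close> may stay bounded by a smaller number. Shifting the centre to the right
  by the constant \<open>a + C1 * t\<close> makes the hypothesis applicable; the radius grows linearly in \<open>T\<close>
  and absorbs both the shift and the distance of the two trajectories.
\<close>

lemma transported_maps_injective:
  assumes "0 < a" "0 < c" "0 \<le> t"
    and inj: "\<And>T z. T1 \<le> T \<Longrightarrow> a + C1 * T < Re z \<Longrightarrow> inj_on (h T) (ball z (c * Re z))"
    and z: "0 < Re z" and w: "0 < Re w"
    and eq: "\<And>T. T0 \<le> T \<Longrightarrow> t \<le> T \<Longrightarrow> h T (flow t T z) = h T (flow t T w)"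
  shows "z = w"
proof -
  \<comment> \<open>The shift of the centre: it raises the real part, which exceeds \<open>C1 * (T - t)\<close>, above \<open>a + C1 * T\<close>.\<close>
  define M where "M = a + C1 * t"
  have M: "M > 0" using assms C1_pos by (simp add: M_def add_pos_nonneg)
  define d where "d n = cmod (flow t (t + real n) z - flow t (t + real n) w)" for n
  have "(\<lambda>n. M * inverse (real n) + d n / real n) \<longlonglongrightarrow> M * 0 + 0"
    unfolding d_def by (intro tendsto_intros lim_inverse_n flow_distance_sublinear z w)
  then have "\<forall>\<^sub>F n in sequentially. M * inverse (real n) + d n / real n < c * C1"
    using assms(2) C1_pos by (intro order_tendstoD(2)) auto
  moreover have "\<forall>\<^sub>F n in sequentially. nat \<lceil>max T0 T1\<rceil> \<le> n" by (rule eventually_ge_at_top)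
  moreover have "\<forall>\<^sub>F n in sequentially. 0 < n" by (rule eventually_gt_at_top)
  ultimately have "\<forall>\<^sub>F n in sequentially. M * inverse (real n) + d n / real n < c * C1 \<and> nat \<lceil>max T0 T1\<rceil> \<le> n \<and> 0 < n"
    by eventually_elim simp
  then obtain n where n: "M * inverse (real n) + d n / real n < c * C1" "nat \<lceil>max T0 T1\<rceil> \<le> n" "0 < n"
    using eventually_happens[of _ sequentially] by auto
  define T where "T = t + real n"
  have T: "T0 \<le> T" "T1 \<le> T" "t \<le> T" using n(2) assms(3) unfolding T_def by linarith+
  have lt: "M + d n < c * (C1 * real n)" using n(1,3) by (simp add: field_simps)
  define \<zeta> where "\<zeta> = flow t T z + of_real M"
  have Re_flow: "Re z + C1 * real n \<le> Re (flow t T z)"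
    using flow_Re_bounds(1)[OF z T(3)] by (simp add: T_def)
  have \<zeta>: "a + C1 * T < Re \<zeta>"
    using Re_flow z by (simp add: \<zeta>_def M_def T_def algebra_simps)
  have "c * (C1 * real n) \<le> c * Re \<zeta>"
    using Re_flow z M assms(2) by (intro mult_left_mono) (auto simp: \<zeta>_def)
  with lt have lt': "M + d n < c * Re \<zeta>" by simp
  have "flow t T z \<in> ball \<zeta> (c * Re \<zeta>)"
  proof -
    have "dist \<zeta> (flow t T z) = M" using M by (simp add: \<zeta>_def dist_norm)
    moreover have "0 \<le> d n" by (simp add: d_def)
    ultimately show ?thesis using lt' by simp
  qed
  moreover have "flow t T w \<in> ball \<zeta> (c * Re \<zeta>)"
  proof -
    have "dist \<zeta> (flow t T w) \<le> cmod (of_real M) + cmod (flow t T z - flow t T w)"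
      using norm_triangle_ineq[of "of_real M" "flow t T z - flow t T w"]
      by (simp add: \<zeta>_def dist_norm algebra_simps)
    then show ?thesis using lt' M by (simp add: d_def T_def)
  qed
  ultimately have "flow t T z = flow t T w"
    using inj_onD[OF inj[OF T(2) \<zeta>] eq[OF T(1,3)]] by blast
  then show ?thesis using flow_injective[OF z w T(3)] by blast
qed

text \<open>
  Up to the time horizon \<open>N\<close> all maps \<open>g t\<close> factor through the single map \<open>h T\<close> with
  \<open>T = N + x0 / C1\<close>, and \<open>g s z\<close> and \<open>g t z\<close> are its values at the images under \<open>flow t T\<close> of
  \<open>flow s t z\<close> and \<open>z\<close>. Both maps are Lipschitz on the compact sets involved, so the difference is
  controlled by the displacement \<open>flow s t z - z\<close>.
\<close>

lemma transported_maps_integral_bound: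
  assumes K: "compact K" "K \<subseteq> right_half_plane" "K \<noteq> {}" and x0: "0 < x0"
    and hol: "\<And>t. 0 \<le> t \<Longrightarrow> h t holomorphic_on half_plane x0"
    and g: "\<And>t T z. 0 \<le> t \<Longrightarrow> t + x0 / C1 \<le> T \<Longrightarrow> 0 < Re z \<Longrightarrow> g t z = h T (flow t T z)"
  obtains k where "\<And>u::real. 0 \<le> k u" "locally_integrable k"
    "\<And>z s t. z \<in> K \<Longrightarrow> 0 \<le> s \<Longrightarrow> s \<le> t \<Longrightarrow> cmod (g s z - g t z) \<le> (LINT u:{s..t}|lebesgue. k u)"
proof -
  obtain \<zeta> where \<zeta>: "\<zeta> \<in> K" "\<And>z. z \<in> K \<Longrightarrow> Re \<zeta> \<le> Re z"
    using continuous_attains_inf[OF K(1,3), of Re] continuous_on_Re[OF continuous_on_id] by auto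
  define \<epsilon> where "\<epsilon> = min 1 (Re \<zeta>)"
  have \<epsilon>: "0 < \<epsilon>" "\<epsilon> \<le> 1" "\<And>z. z \<in> K \<Longrightarrow> \<epsilon> \<le> Re z" using \<zeta> K(2) by (force simp: \<epsilon>_def)+
  obtain R0 where R0: "\<And>z. z \<in> K \<Longrightarrow> cmod z \<le> R0" using compact_imp_bounded[OF K(1)] unfolding bounded_iff by blast
  have R00: "0 \<le> R0" using R0[OF \<zeta>(1)] by (rule order_trans[OF norm_ge_zero])
  define L where "L = C2 / \<epsilon>"
  have L: "0 < L" using C2_pos \<epsilon> by (simp add: L_def)
  define \<tau> where "\<tau> = x0 / C1"
  have \<tau>: "0 < \<tau>" "C1 * \<tau> = x0" using x0 C1_pos by (auto simp: \<tau>_def)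
  \<comment> \<open>A majorant of the field on \<open>K\<close>, obtained from its values at the single point \<open>1\<close>.\<close>
  define m where "m u = cmod (q 1 u) + L * (R0 + 1)" for u
  have m0: "0 \<le> m u" for u using L R00 by (simp add: m_def)
  have mint: "m integrable_on {a..b}" for a b
    unfolding m_def by (intro integrable_add field_integrable_on(2) integrable_const_ivl) simp
  have qm: "cmod (q z u) \<le> m u" if "z \<in> K" for z u
  proof -
    have "cmod (q z u) \<le> cmod (q 1 u) + cmod (q z u - q 1 u)" using norm_triangle_sub by blast
    also have "cmod (q z u - q 1 u) \<le> L * cmod (z - 1)"
      unfolding L_def using \<epsilon> that by (intro field_lipschitz) auto
    also have "\<dots> \<le> L * (R0 + 1)"
      using L R0[OF that] norm_triangle_ineq4[of z 1] by (intro mult_left_mono) auto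
    finally show ?thesis by (simp add: m_def)
  qed
  have displ: "cmod (flow s t z - z) \<le> exp (L * (t - s)) * integral {s..t} m" if "z \<in> K" "s \<le> t" for z s t
  proof -
    have "cmod (flow s t z - z) \<le> exp (L * (t - s)) * integral {s..t} (\<lambda>u. cmod (q z u))"
      unfolding L_def by (rule flow_displacement[OF \<epsilon>(1) \<epsilon>(3)[OF that(1)] that(2)])
    also have "\<dots> \<le> exp (L * (t - s)) * integral {s..t} m"
      using \<epsilon>(1) \<epsilon>(3)[OF that(1)] qm[OF that(1)]
      by (intro mult_left_mono integral_le field_integrable_on(2) mint) auto
    finally show ?thesis .
  qed
  have "\<exists>B\<ge>0. \<forall>z\<in>K. \<forall>s t. 0 \<le> s \<longrightarrow> s \<le> t \<longrightarrow> t \<le> real N \<longrightarrow>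
      cmod (g s z - g t z) \<le> B * integral {s..t} m" for N
  proof -
    define T where "T = real N + \<tau>"
    have T: "0 \<le> T" using \<tau> by (simp add: T_def)
    define R where "R = R0 + exp (L * T) * integral {0..T} m"
    have I0: "0 \<le> integral {a..b} m" for a b by (rule integral_nonneg[OF mint]) (rule m0)
    have R: "0 \<le> R" using R00 I0 by (simp add: R_def)
    \<comment> \<open>A compact convex set inside \<open>half_plane x0\<close> that contains, at time \<open>T\<close>, every trajectory that starts in \<open>K\<close> at a time up to \<open>N\<close>.\<close>
    define Q where "Q = {\<zeta>. x0 + \<epsilon> \<le> Re \<zeta>} \<inter> cball 0 R"
    have Q: "compact Q" "convex Q" "Q \<subseteq> half_plane x0"
      unfolding Q_def using \<epsilon>(1)
      by (auto intro: closed_Int_compact closed_halfspace_Re_ge convex_Int convex_halfspace_Re_ge)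
    have "continuous_on Q (deriv (h T))"
      using holomorphic_on_imp_continuous_on[OF holomorphic_deriv[OF hol[OF T] open_half_plane]] Q(3)
      by (rule continuous_on_subset)
    then have "bounded (deriv (h T) ` Q)"
      by (intro compact_imp_bounded compact_continuous_image Q)
    then obtain B0 where B0: "\<And>\<zeta>. \<zeta> \<in> Q \<Longrightarrow> cmod (deriv (h T) \<zeta>) \<le> B0" unfolding bounded_iff by blast
    define B where "B = max 0 B0"
    have hlip: "cmod (h T \<zeta> - h T \<xi>) \<le> B * cmod (\<zeta> - \<xi>)" if "\<zeta> \<in> Q" "\<xi> \<in> Q" for \<zeta> \<xi>
    proof (rule field_differentiable_bound[OF Q(2) _ _ that, where f' = "deriv (h T)"])
      fix w assume w: "w \<in> Q"
      then have "(h T has_field_derivative deriv (h T) w) (at w)"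
        using holomorphic_derivI[OF hol[OF T] open_half_plane] Q(3) by blast
      then show "(h T has_field_derivative deriv (h T) w) (at w within Q)"
        by (rule has_field_derivative_at_within)
      show "cmod (deriv (h T) w) \<le> B" using B0[OF w] by (simp add: B_def)
    qed
    have flowQ: "flow s T z \<in> Q" if "z \<in> K" "0 \<le> s" "s \<le> real N" for s z
    proof -
      have sT: "s \<le> T" "\<tau> \<le> T - s" using that \<tau> by (auto simp: T_def)
      have z: "0 < Re z" "\<epsilon> \<le> Re z" using \<epsilon>(1) \<epsilon>(3)[OF that(1)] by auto
      have "x0 \<le> C1 * (T - s)" using mult_left_mono[OF sT(2), of C1] C1_pos \<tau> by simp
      then have "x0 + \<epsilon> \<le> Re (flow s T z)" using flow_Re_bounds(1)[OF z(1) sT(1)] z by simp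
      moreover have "cmod (flow s T z) \<le> R"
      proof -
        have "cmod (flow s T z) \<le> cmod z + cmod (flow s T z - z)" by (rule norm_triangle_sub)
        also have "cmod (flow s T z - z) \<le> exp (L * (T - s)) * integral {s..T} m" by (rule displ[OF that(1) sT(1)])
        also have "\<dots> \<le> exp (L * T) * integral {0..T} m"
        proof (rule mult_mono)
          show "integral {s..T} m \<le> integral {0..T} m"
            by (rule integral_subset_le[OF _ mint mint]) (use that m0 in auto)
        qed (use L that I0 in auto)
        finally show ?thesis using R0[OF that(1)] by (simp add: R_def)
      qed
      ultimately show ?thesis by (simp add: Q_def)
    qed
    show ?thesis
    proof (intro exI[of _ "B * (R / \<epsilon>) * exp (L * real N)"] conjI ballI allI impI)
      show "0 \<le> B * (R / \<epsilon>) * exp (L * real N)" using R \<epsilon>(1) by (simp add: B_def)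
      fix z s t assume z: "z \<in> K" and st: "0 \<le> s" "s \<le> t" "t \<le> real N"
      have z0: "0 < Re z" "\<epsilon> \<le> Re z" using \<epsilon>(1) \<epsilon>(3)[OF z] by auto
      have tT: "t \<le> T" "s \<le> T" "t + x0 / C1 \<le> T" "s + x0 / C1 \<le> T" using st \<tau> by (auto simp: T_def \<tau>_def)
      have sg: "flow t T (flow s t z) = flow s T z" by (rule flow_semigroup[OF z0(1) st(2) tT(1)])
      have "cmod (g s z - g t z) = cmod (h T (flow s T z) - h T (flow t T z))"
        using g[OF st(1) tT(4) z0(1)] g[OF _ tT(3) z0(1)] st by simp
      also have "\<dots> \<le> B * cmod (flow s T z - flow t T z)"
        using z st by (intro hlip flowQ) auto
      also have "\<dots> \<le> B * (R / \<epsilon> * cmod (flow s t z - z))"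
      proof (rule mult_left_mono)
        have "Re (flow s T z) \<le> R" "Re (flow t T z) \<le> R"
          using flowQ[OF z, of s] flowQ[OF z, of t] st complex_Re_le_cmod[of "flow s T z"] complex_Re_le_cmod[of "flow t T z"]
          by (auto simp: Q_def)
        then show "cmod (flow s T z - flow t T z) \<le> R / \<epsilon> * cmod (flow s t z - z)"
          using half_plane_map_lipschitz[OF flow_holomorphic[OF tT(1)] _ \<epsilon>(1), of "flow s t z" z R]
            flow_Re_pos[OF _ tT(1)] flow_Re_ge[OF z0(1) st(2)] z0(2) by (simp add: sg)
      qed (simp add: B_def)
      also have "\<dots> \<le> B * (R / \<epsilon> * (exp (L * real N) * integral {s..t} m))"
      proof (intro mult_left_mono)
        have "exp (L * (t - s)) \<le> exp (L * real N)" using L st by simp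
        then have "exp (L * (t - s)) * integral {s..t} m \<le> exp (L * real N) * integral {s..t} m"
          by (rule mult_right_mono[OF _ I0])
        with displ[OF z st(2)] show "cmod (flow s t z - z) \<le> exp (L * real N) * integral {s..t} m" by simp
      qed (use R \<epsilon>(1) in \<open>auto simp: B_def\<close>)
      finally show "cmod (g s z - g t z) \<le> B * (R / \<epsilon>) * exp (L * real N) * integral {s..t} m"
        by (simp only: ac_simps)
    qed
  qed
  then obtain B where B: "\<And>N. 0 \<le> B N" "\<And>N z s t. z \<in> K \<Longrightarrow> 0 \<le> s \<Longrightarrow> s \<le> t \<Longrightarrow> t \<le> real N \<Longrightarrow>
      cmod (g s z - g t z) \<le> B N * integral {s..t} m"
    by metis
  show ?thesis
    using integral_bound_glue[of m B K "\<lambda>z t. g t z", OF mint m0 B] that by blast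
qed

end

theorem theorem4p3:
  fixes x0 :: real
    and h :: "real \<Rightarrow> complex \<Rightarrow> complex"
    and C1 C2 :: real
    and p :: "complex \<Rightarrow> real \<Rightarrow> complex"
  assumes "0 < x0"
    and "\<And>t. 0 \<le> t \<Longrightarrow> h t holomorphic_on half_plane x0"
    and "continuous_on (half_plane x0 \<times> {0..}) (\<lambda>(z, t). h t z)"
    and "\<And>z. z \<in> half_plane x0 \<Longrightarrow> locally_abs_continuous_from 0 (\<lambda>t. h t z)"
    and "0 < C1" and "C1 < C2"
    and "herglotz_function p"
    and "\<And>z t. z \<in> right_half_plane \<Longrightarrow> 0 \<le> t \<Longrightarrow> C1 < Re (p z t) \<and> Re (p z t) < C2"
    and "\<And>z. z \<in> half_plane x0 \<Longrightarrow>
           AE t in lebesgue. 0 \<le> t \<longrightarrow>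
             ((\<lambda>t. h t z) has_vector_derivative - deriv (h t) z * p z t) (at t within {0..})"
    and "\<exists>a>x0. 0 < Liminf at_top (\<lambda>t::real.
           INF z\<in>half_plane (a + C1 * t). radius_of_univalence (half_plane x0) (h t) z / ereal (Re z))"
  shows "\<exists>g. (\<forall>t\<ge>0. univalent_on (g t) right_half_plane \<and> (\<forall>z\<in>half_plane x0. g t z = h t z)) \<and>
             loewner_chain_associated g p"
proof -
  note x0 = assms(1) and hol = assms(2) and C1 = assms(5)
  obtain q where q: "strip_field q C1 C2" and qp: "AE t in lebesgue. 0 \<le> t \<longrightarrow> (\<forall>z. q z t = p z t)"
    using strip_field_of_herglotz_function[OF assms(7,5,6,8)] by blast
  interpret strip_field q C1 C2 by (rule q)
  have pde: "AE t in lebesgue. 0 \<le> t \<longrightarrow>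
      ((\<lambda>t. h t z) has_vector_derivative - deriv (h t) z * q z t) (at t within {0..})"
    if "z \<in> half_plane x0" for z
    using assms(9)[OF that] qp
  proof eventually_elim
    case (elim t)
    then show ?case by auto
  qed
  have transport: "h t (flow s t z) = h s z" if "x0 < Re z" "0 \<le> s" "s \<le> t" for s t z
    by (rule transport_along_flow[OF less_imp_le[OF x0] hol assms(3,4) pde that])
  obtain a c T1 where a: "x0 < a" "0 < c"
    and inj: "\<And>T z. T1 \<le> T \<Longrightarrow> a + C1 * T < Re z \<Longrightarrow> inj_on (h T) (ball z (c * Re z))"
  proof -
    obtain a where "x0 < a" and lim: "0 < Liminf at_top (\<lambda>t::real.
           INF z\<in>half_plane (a + C1 * t). radius_of_univalence (half_plane x0) (h t) z / ereal (Re z))"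
      using assms(10) by blast
    then have "0 < a" using x0 by simp
    obtain c T1 where "0 < c" "\<And>T z. T1 \<le> T \<Longrightarrow> a + C1 * T < Re z \<Longrightarrow> inj_on (h T) (ball z (c * Re z))"
      using univalent_disks_of_Liminf[OF \<open>0 < a\<close> C1 lim] by blast
    with \<open>x0 < a\<close> show ?thesis by (rule that)
  qed
  \<comment> \<open>The time that every trajectory needs at most to enter \<open>half_plane x0\<close>.\<close>
  define \<tau> where "\<tau> = x0 / C1"
  have \<tau>: "0 < \<tau>" "C1 * \<tau> = x0" using x0 C1 by (auto simp: \<tau>_def)
  define g where "g t z = h (t + \<tau>) (flow t (t + \<tau>) z)" for t z
  have flow_x0: "x0 < Re (flow t (t + \<tau>) z)" if "0 < Re z" for t z
    using flow_Re_bounds(1)[OF that, of t "t + \<tau>"] \<tau> that by simp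
  have g_eq: "g t z = h T (flow t T z)" if "0 \<le> t" "t + \<tau> \<le> T" "0 < Re z" for t T z
    using transport[OF flow_x0[OF that(3)], of "t + \<tau>" T t] flow_semigroup[OF that(3), of t "t + \<tau>" T] that \<tau>
    by (simp add: g_def)
  have g_h: "g t z = h t z" if "0 \<le> t" "x0 < Re z" for t z
    unfolding g_def using transport[OF that(2,1)] \<tau> by simp
  have g_flow: "g t (flow s t z) = g s z" if "0 \<le> s" "s \<le> t" "0 < Re z" for s t z
    using g_eq[of s "t + \<tau>" z] flow_semigroup[OF that(3,2), of "t + \<tau>"] that \<tau> by (simp add: g_def)
  have g_hol: "g t holomorphic_on right_half_plane" if "0 \<le> t" for t
  proof -
    have "h (t + \<tau>) \<circ> flow t (t + \<tau>) holomorphic_on right_half_plane"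
      by (rule holomorphic_on_compose_gen[OF flow_holomorphic hol]) (use \<tau> that flow_x0 in auto)
    then show ?thesis by (simp add: g_def[abs_def] o_def)
  qed
  have g_inj: "inj_on (g t) right_half_plane" if t: "0 \<le> t" for t
  proof (rule inj_onI)
    fix z w assume zw: "z \<in> right_half_plane" "w \<in> right_half_plane" "g t z = g t w"
    show "z = w"
    proof (rule transported_maps_injective[of a c t T1 h z w "t + \<tau>"])
      show "h T (flow t T z) = h T (flow t T w)" if "t + \<tau> \<le> T" for T
        using g_eq[OF t that] zw by simp
    qed (use a x0 t inj zw in auto)
  qed
  have chain: "loewner_chain g"
    unfolding loewner_chain_def
  proof (intro conjI allI impI)
    show "univalent_on (g t) right_half_plane" if "0 \<le> t" for t
      unfolding univalent_on_def using g_hol g_inj that by blast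
    show "g s ` right_half_plane \<subseteq> g t ` right_half_plane" if "0 \<le> s \<and> s < t" for s t
    proof (rule image_subsetI)
      fix z assume "z \<in> right_half_plane"
      then have z: "0 < Re z" by simp
      have "g s z = g t (flow s t z)" using g_flow[of s t z] that z by simp
      moreover have "flow s t z \<in> right_half_plane" using flow_Re_pos[of z s t] that z by simp
      ultimately show "g s z \<in> g t ` right_half_plane" by blast
    qed
    fix K assume K: "compact K \<and> K \<subseteq> right_half_plane"
    show "\<exists>k :: real \<Rightarrow> real. (\<forall>\<xi>\<ge>0. 0 \<le> k \<xi>) \<and> locally_integrable k \<and>
           (\<forall>z\<in>K. \<forall>s t. 0 \<le> s \<and> s \<le> t \<longrightarrow> cmod (g s z - g t z) \<le> (LINT \<xi>:{s..t}|lebesgue. k \<xi>))"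
    proof (cases "K = {}")
      case True
      then show ?thesis by (intro exI[of _ "\<lambda>_. 0"]) (simp add: locally_integrable_def)
    next
      case False
      obtain k where "\<And>u::real. 0 \<le> k u" "locally_integrable k"
        "\<And>z s t. z \<in> K \<Longrightarrow> 0 \<le> s \<Longrightarrow> s \<le> t \<Longrightarrow> cmod (g s z - g t z) \<le> (LINT u:{s..t}|lebesgue. k u)"
        using transported_maps_integral_bound[of K x0 h g] K False x0 hol g_eq unfolding \<tau>_def by blast
      then show ?thesis by blast
    qed
  qed
  have "inv_into right_half_plane (g t) (g s z) = flow s t z" if "0 \<le> s \<and> s \<le> t" "z \<in> right_half_plane" for s t z
    using inv_into_f_f[OF g_inj, of t "flow s t z"] g_flow[of s t z] flow_Re_pos[of z s t] that by simp
  then have "loewner_chain_associated g p"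
    unfolding loewner_chain_associated_def using chain evolution_family_of_flow[OF qp] by blast
  moreover have "\<forall>t\<ge>0. univalent_on (g t) right_half_plane \<and> (\<forall>z\<in>half_plane x0. g t z = h t z)"
    unfolding univalent_on_def using g_hol g_inj g_h by simp
  ultimately show ?thesis by blast
qed

end
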